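(* Let $H$ be a Hopf algebra over $\mathbb K$, $\mathcal F\in H\otimes H$ a twist of $H$ with $\mathcal F^{-1}=\bar f^\alpha\otimes\bar f_\alpha$, $A$ a left $H$-module algebra and $V$ a left $H$-module $A$-bimodule. Then the map $$D_{\mathcal F}:\mathrm{End}_{A}(V)_\star\longrightarrow \mathrm{End}_{A_\star}(V_\star),\qquad P\longmapsto D_{\mathcal F}(P):=(\bar f^\alpha\blacktriangleright P)\circ \bar f_\alpha\triangleright$$ is an isomorphism between the left $H^{\mathcal F}$-module $A_\star$-bimodule algebras $(\mathrm{End}_{A}(V)_\star,\blacktriangleright)$ and $(\mathrm{End}_{A_\star}(V_\star),\blacktriangleright_{\mathcal F})$ (that is, a bijection which is an algebra morphism, an $A_\star$-bimodule morphism and intertwines the $H^{\mathcal F}$-actions).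
   Context: $\mathbb K$ is a commutative ring with unit; modules, algebras (associative, unital) and unadorned tensor products are over $\mathbb K$. For a Hopf algebra $H$ with coproduct $\Delta$, counit $\varepsilon$, antipode $S$, write $\Delta(\xi)=\xi_1\otimes\xi_2$ (sum understood). A left $H$-module algebra is an algebra $A$ with a left $H$-module structure $\triangleright$ such that $\xi\triangleright(ab)=(\xi_1\triangleright a)(\xi_2\triangleright b)$, $\xi\triangleright1=\varepsilon(\xi)1$. A left $H$-module $A$-bimodule is an $A$-bimodule $V$ that is also a left $H$-module with $\xi\triangleright(a\cdot v)=(\xi_1\triangleright a)\cdot(\xi_2\triangleright v)$ and $\xi\triangleright(v\cdot a)=(\xi_1\triangleright v)\cdot(\xi_2\triangleright a)$. A left $H$-module $A$-bimodule algebra is a left $H$-module $A$-bimodule that is also a left $H$-module algebra. A twist of $H$ is an invertible $\mathcal F\in H\otimes H$ with $(\mathcal F\otimes 1)(\Delta\otimes\mathrm{id})\mathcal F=(1\otimes\mathcal F)(\mathrm{id}\otimes\Delta)\mathcal F$ and $(\varepsilon\otimes\mathrm{id})\mathcal F=1=(\mathrm{id}\otimes\varepsilon)\mathcal F$. Write $\mathcal F=f^\alpha\otimes f_\alpha$, $\mathcal F^{-1}=\bar f^\alpha\otimes\bar f_\alpha$. The twisted Hopf algebra $H^{\mathcal F}$ has the same algebra structure and counit as $H$, coproduct $\Delta^{\mathcal F}(\xi)=\mathcal F\Delta(\xi)\mathcal F^{-1}=\xi_{1_{\mathcal F}}\otimes\xi_{2_{\mathcal F}}$, and antipode $S^{\mathcal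 F}(\xi)=\chi S(\xi)\chi^{-1}$ with $\chi=f^\alpha S(f_\alpha)$. $A_\star$ is the left $H^{\mathcal F}$-module algebra with the same $\mathbb K$-module, unit and action as $A$ and product $a\star b=(\bar f^\alpha\triangleright a)(\bar f_\alpha\triangleright b)$. For a left $H$-module $A$-bimodule $V$, $V_\star$ is the left $H^{\mathcal F}$-module $A_\star$-bimodule with the same $\mathbb K$-module and action as $V$ and with $a\star v=(\bar f^\alpha\triangleright a)\cdot(\bar f_\alpha\triangleright v)$, $v\star a=(\bar f^\alpha\triangleright v)\cdot(\bar f_\alpha\triangleright a)$. If $V=E$ is also an algebra, $E_\star$ has in addition the product $e\star e'=(\bar f^\alpha\triangleright e)(\bar f_\alpha\triangleright e')$. $\mathrm{End}_A(V)$ denotes the right $A$-linear endomorphisms of $V$. It is a left $H$-module $A$-bimodule algebra with product $\circ$, action $\xi\blacktriangleright P:=\xi_1\triangleright\circ P\circ S(\xi_2)\triangleright$, and $a\cdot P=l_a\circ P$, $P\cdot a=P\circ l_a$, where $l_a(v)=a\cdot v$. $\mathrm{End}_A(V)_\star$ is its deformation in the sense above (with $H$-action $\blacktriangleright$); its product is $P\circ_\star Q=(\bar f^\alpha\blacktriangleright P)\circ(\bar f_\alpha\blacktriangleright Q)$. $\mathrm{End}_{A_\star}(V_\star)$ is the algebra of right $A_\star$-linear endomorphisms of $V_\star$ with product $\circ$, $A_\star$-bimodule structure $a\cdot P=l^\star_a\circ P$, $P\cdot a=P\circ l^\star_a$, where $l^\star_a(v)=a\star v$, and $H^{\mathcal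 F}$-action $\xi\blacktriangleright_{\mathcal F}P:=\xi_{1_{\mathcal F}}\triangleright\circ P\circ S^{\mathcal F}(\xi_{2_{\mathcal F}})\triangleright$. *)

theory Defs
  imports Complex_Main "HOL-Library.Function_Algebras"
begin

section \<open>Tensor products\<close>

text \<open>
  Let \<open>H\<close> be a \<open>\<bbbK>\<close>-module with scalar multiplication \<open>s\<close>. A list of pairs stands for the formal sum
  of the corresponding pure tensors, and \<open>teq2 s\<close> is the congruence that turns formal sums into
  \<open>H \<otimes> H\<close>: the least one making addition commutative and \<open>\<otimes>\<close> biadditive and \<open>\<bbbK>\<close>-balanced.
  The scalar action and the additive inverses of \<open>H \<otimes> H\<close> come from those of the left factor.
\<close>

inductive teq2 ::
  "('k::comm_ring_1 \<Rightarrow> 'h::ab_group_add \<Rightarrow> 'h) \<Rightarrow> ('h \<times> 'h) list \<Rightarrow> ('h \<times> 'h) list \<Rightarrow> bool"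
  for s where
  refl: "teq2 s t t"
| sym: "teq2 s t u \<Longrightarrow> teq2 s u t"
| trans: "teq2 s t u \<Longrightarrow> teq2 s u v \<Longrightarrow> teq2 s t v"
| append: "teq2 s t t' \<Longrightarrow> teq2 s u u' \<Longrightarrow> teq2 s (t @ u) (t' @ u')"
| commute: "teq2 s (t @ u) (u @ t)"
| add_left: "teq2 s [(x + x', y)] [(x, y), (x', y)]"
| add_right: "teq2 s [(x, y + y')] [(x, y), (x, y')]"
| zero: "teq2 s [(0, y)] []"
| balanced: "teq2 s [(s k x, y)] [(x, s k y)]"

text \<open>The same for \<open>H \<otimes> H \<otimes> H\<close>.\<close>

inductive teq3 ::
  "('k::comm_ring_1 \<Rightarrow> 'h::ab_group_add \<Rightarrow> 'h)
    \<Rightarrow> ('h \<times> 'h \<times> 'h) list \<Rightarrow> ('h \<times> 'h \<times> 'h) list \<Rightarrow> bool"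
  for s where
  refl: "teq3 s t t"
| sym: "teq3 s t u \<Longrightarrow> teq3 s u t"
| trans: "teq3 s t u \<Longrightarrow> teq3 s u v \<Longrightarrow> teq3 s t v"
| append: "teq3 s t t' \<Longrightarrow> teq3 s u u' \<Longrightarrow> teq3 s (t @ u) (t' @ u')"
| commute: "teq3 s (t @ u) (u @ t)"
| add1: "teq3 s [(x + x', y, z)] [(x, y, z), (x', y, z)]"
| add2: "teq3 s [(x, y + y', z)] [(x, y, z), (x, y', z)]"
| add3: "teq3 s [(x, y, z + z')] [(x, y, z), (x, y, z')]"
| zero: "teq3 s [(0, y, z)] []"
| balanced12: "teq3 s [(s k x, y, z)] [(x, s k y, z)]"
| balanced23: "teq3 s [(x, s k y, z)] [(x, y, s k z)]"

type_synonym 'h tensor2 = "('h \<times> 'h) list set"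
type_synonym 'h tensor3 = "('h \<times> 'h \<times> 'h) list set"

definition cls2 :: "('k::comm_ring_1 \<Rightarrow> 'h::ab_group_add \<Rightarrow> 'h) \<Rightarrow> ('h \<times> 'h) list \<Rightarrow> 'h tensor2"
  where "cls2 s t = {u. teq2 s t u}"

definition cls3 ::
  "('k::comm_ring_1 \<Rightarrow> 'h::ab_group_add \<Rightarrow> 'h) \<Rightarrow> ('h \<times> 'h \<times> 'h) list \<Rightarrow> 'h tensor3"
  where "cls3 s t = {u. teq3 s t u}"

definition tensors2 :: "('k::comm_ring_1 \<Rightarrow> 'h::ab_group_add \<Rightarrow> 'h) \<Rightarrow> 'h tensor2 set"
  where "tensors2 s = range (cls2 s)"

text \<open>
  Sweedler notation: \<open>rep T\<close> is a chosen formal sum \<open>\<Sum> x\<^sub>i \<otimes> y\<^sub>i\<close> representing \<open>T\<close>. The operations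
  below are used only where the result does not depend on this choice.
\<close>

definition rep :: "'t list set \<Rightarrow> 't list"
  where "rep T = (SOME t. t \<in> T)"

text \<open>The additive map on \<open>H \<otimes> H\<close> induced by a biadditive balanced map \<open>\<beta>\<close> on \<open>H \<times> H\<close>.\<close>

definition lift2 :: "('h \<Rightarrow> 'h \<Rightarrow> 'c::ab_group_add) \<Rightarrow> 'h tensor2 \<Rightarrow> 'c"
  where "lift2 \<beta> T = (\<Sum>(x, y) \<leftarrow> rep T. \<beta> x y)"

lemma lift2_cls2:
  assumes addl: "\<And>x x' y. \<beta> (x + x') y = \<beta> x y + \<beta> x' y"
    and addr: "\<And>x y y'. \<beta> x (y + y') = \<beta> x y + \<beta> x y'"
    and bal: "\<And>k x y. \<beta> (s k x) y = \<beta> x (s k y)"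
  shows "lift2 \<beta> (cls2 s t) = (\<Sum>(x, y) \<leftarrow> t. \<beta> x y)"
proof -
  have zero: "\<beta> 0 y = 0" for y
    using addl[of 0 0 y] by simp
  have wd: "teq2 s t u \<Longrightarrow> (\<Sum>(x, y) \<leftarrow> t. \<beta> x y) = (\<Sum>(x, y) \<leftarrow> u. \<beta> x y)" for t u
    by (induction rule: teq2.induct) (simp_all add: addl addr bal zero add.commute)
  have "rep (cls2 s t) \<in> cls2 s t"
    unfolding rep_def by (rule someI[of _ t]) (simp add: cls2_def teq2.refl)
  then show ?thesis
    using wd[of t "rep (cls2 s t)"] by (simp add: lift2_def cls2_def)
qed

definition tadd2 ::
  "('k::comm_ring_1 \<Rightarrow> 'h::ab_group_add \<Rightarrow> 'h) \<Rightarrow> 'h tensor2 \<Rightarrow> 'h tensor2 \<Rightarrow> 'h tensor2"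
  where "tadd2 s T U = cls2 s (rep T @ rep U)"

definition tscale2 ::
  "('k::comm_ring_1 \<Rightarrow> 'h::ab_group_add \<Rightarrow> 'h) \<Rightarrow> 'k \<Rightarrow> 'h tensor2 \<Rightarrow> 'h tensor2"
  where "tscale2 s k T = cls2 s [(s k x, y). (x, y) \<leftarrow> rep T]"

definition tone2 :: "('k::comm_ring_1 \<Rightarrow> 'h::ring_1 \<Rightarrow> 'h) \<Rightarrow> 'h tensor2"
  where "tone2 s = cls2 s [(1, 1)]"

definition tmult2 ::
  "('k::comm_ring_1 \<Rightarrow> 'h::ring_1 \<Rightarrow> 'h) \<Rightarrow> 'h tensor2 \<Rightarrow> 'h tensor2 \<Rightarrow> 'h tensor2"
  where "tmult2 s T U = cls2 s [(x * x', y * y'). (x, y) \<leftarrow> rep T, (x', y') \<leftarrow> rep U]"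

definition tmult3 ::
  "('k::comm_ring_1 \<Rightarrow> 'h::ring_1 \<Rightarrow> 'h) \<Rightarrow> 'h tensor3 \<Rightarrow> 'h tensor3 \<Rightarrow> 'h tensor3"
  where "tmult3 s T U =
    cls3 s [(x * x', y * y', z * z'). (x, y, z) \<leftarrow> rep T, (x', y', z') \<leftarrow> rep U]"

definition tensor_one :: "('k::comm_ring_1 \<Rightarrow> 'h::ring_1 \<Rightarrow> 'h) \<Rightarrow> 'h tensor2 \<Rightarrow> 'h tensor3"
  where "tensor_one s T = cls3 s [(x, y, 1). (x, y) \<leftarrow> rep T]"

definition one_tensor :: "('k::comm_ring_1 \<Rightarrow> 'h::ring_1 \<Rightarrow> 'h) \<Rightarrow> 'h tensor2 \<Rightarrow> 'h tensor3"
  where "one_tensor s T = cls3 s [(1, x, y). (x, y) \<leftarrow> rep T]"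

text \<open>\<open>(\<Delta> \<otimes> id) T\<close> and \<open>(id \<otimes> \<Delta>) T\<close>\<close>

definition map_left ::
  "('k::comm_ring_1 \<Rightarrow> 'h::ab_group_add \<Rightarrow> 'h) \<Rightarrow> ('h \<Rightarrow> 'h tensor2) \<Rightarrow> 'h tensor2 \<Rightarrow> 'h tensor3"
  where "map_left s \<Delta> T = cls3 s [(x\<^sub>1, x\<^sub>2, y). (x, y) \<leftarrow> rep T, (x\<^sub>1, x\<^sub>2) \<leftarrow> rep (\<Delta> x)]"

definition map_right ::
  "('k::comm_ring_1 \<Rightarrow> 'h::ab_group_add \<Rightarrow> 'h) \<Rightarrow> ('h \<Rightarrow> 'h tensor2) \<Rightarrow> 'h tensor2 \<Rightarrow> 'h tensor3"
  where "map_right s \<Delta> T = cls3 s [(x, y\<^sub>1, y\<^sub>2). (x, y) \<leftarrow> rep T, (y\<^sub>1, y\<^sub>2) \<leftarrow> rep (\<Delta> y)]"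


section \<open>Algebras and Hopf algebras\<close>

text \<open>An associative unital algebra whose \<open>\<bbbK>\<close>-module is the submodule \<open>E\<close> of a module type.\<close>

locale algebra_on = module s
  for s :: "'k::comm_ring_1 \<Rightarrow> 'e::ab_group_add \<Rightarrow> 'e" +
  fixes E :: "'e set" and m :: "'e \<Rightarrow> 'e \<Rightarrow> 'e" and u :: 'e
  assumes subspace: "subspace E"
    and closed: "\<lbrakk>a \<in> E; b \<in> E\<rbrakk> \<Longrightarrow> m a b \<in> E"
    and unit_closed: "u \<in> E"
    and add_left: "\<lbrakk>a \<in> E; a' \<in> E; b \<in> E\<rbrakk> \<Longrightarrow> m (a + a') b = m a b + m a' b"
    and add_right: "\<lbrakk>a \<in> E; b \<in> E; b' \<in> E\<rbrakk> \<Longrightarrow> m a (b + b') = m a b + m a b'"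
    and scale_left: "\<lbrakk>a \<in> E; b \<in> E\<rbrakk> \<Longrightarrow> m (s k a) b = s k (m a b)"
    and scale_right: "\<lbrakk>a \<in> E; b \<in> E\<rbrakk> \<Longrightarrow> m a (s k b) = s k (m a b)"
    and assoc: "\<lbrakk>a \<in> E; b \<in> E; c \<in> E\<rbrakk> \<Longrightarrow> m (m a b) c = m a (m b c)"
    and unit_left: "a \<in> E \<Longrightarrow> m u a = a"
    and unit_right: "a \<in> E \<Longrightarrow> m a u = a"

text \<open>The ring structure of \<open>H\<close> is that of the type \<open>'h\<close>, hence shared by \<open>H\<close> and its twists.\<close>

record ('k, 'h) hopf =
  hscale :: "'k \<Rightarrow> 'h \<Rightarrow> 'h"
  coprod :: "'h \<Rightarrow> 'h tensor2"
  counit :: "'h \<Rightarrow> 'k"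
  antipode :: "'h \<Rightarrow> 'h"

locale hopf_algebra =
  fixes H :: "('k::comm_ring_1, 'h::ring_1) hopf"
  assumes algebra: "algebra_on (hscale H) UNIV (*) 1"
    and coprod_closed: "coprod H \<xi> \<in> tensors2 (hscale H)"
    and coprod_add: "coprod H (\<xi> + \<eta>) = tadd2 (hscale H) (coprod H \<xi>) (coprod H \<eta>)"
    and coprod_scale: "coprod H (hscale H k \<xi>) = tscale2 (hscale H) k (coprod H \<xi>)"
    and coprod_mult: "coprod H (\<xi> * \<eta>) = tmult2 (hscale H) (coprod H \<xi>) (coprod H \<eta>)"
    and coprod_one: "coprod H 1 = tone2 (hscale H)"
    and counit_linear: "module_hom (hscale H) (*) (counit H)"
    and counit_mult: "counit H (\<xi> * \<eta>) = counit H \<xi> * counit H \<eta>"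
    and counit_one: "counit H 1 = 1"
    and coassociative:
      "map_left (hscale H) (coprod H) (coprod H \<xi>) = map_right (hscale H) (coprod H) (coprod H \<xi>)"
    and counit_left: "lift2 (\<lambda>x y. hscale H (counit H x) y) (coprod H \<xi>) = \<xi>"
    and counit_right: "lift2 (\<lambda>x y. hscale H (counit H y) x) (coprod H \<xi>) = \<xi>"
    and antipode_linear: "module_hom (hscale H) (hscale H) (antipode H)"
    and antipode_left: "lift2 (\<lambda>x y. antipode H x * y) (coprod H \<xi>) = hscale H (counit H \<xi>) 1"
    and antipode_right: "lift2 (\<lambda>x y. x * antipode H y) (coprod H \<xi>) = hscale H (counit H \<xi>) 1"


section \<open>Twists\<close>

definition is_inverse2 ::
  "('k::comm_ring_1 \<Rightarrow> 'h::ring_1 \<Rightarrow> 'h) \<Rightarrow> 'h tensor2 \<Rightarrow> 'h tensor2 \<Rightarrow> bool"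
  where "is_inverse2 s F G \<longleftrightarrow>
    G \<in> tensors2 s \<and> tmult2 s F G = tone2 s \<and> tmult2 s G F = tone2 s"

definition inverse2 :: "('k::comm_ring_1 \<Rightarrow> 'h::ring_1 \<Rightarrow> 'h) \<Rightarrow> 'h tensor2 \<Rightarrow> 'h tensor2"
  where "inverse2 s F = (THE G. is_inverse2 s F G)"

definition twist :: "('k::comm_ring_1, 'h::ring_1) hopf \<Rightarrow> 'h tensor2 \<Rightarrow> bool"
  where "twist H F \<longleftrightarrow>
    F \<in> tensors2 (hscale H) \<and>
    (\<exists>G. is_inverse2 (hscale H) F G) \<and>
    tmult3 (hscale H) (tensor_one (hscale H) F) (map_left (hscale H) (coprod H) F)
      = tmult3 (hscale H) (one_tensor (hscale H) F) (map_right (hscale H) (coprod H) F) \<and>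
    lift2 (\<lambda>x y. hscale H (counit H x) y) F = 1 \<and>
    lift2 (\<lambda>x y. hscale H (counit H y) x) F = 1"

definition twist_chi :: "('k::comm_ring_1, 'h::ring_1) hopf \<Rightarrow> 'h tensor2 \<Rightarrow> 'h"
  where "twist_chi H F = lift2 (\<lambda>x y. x * antipode H y) F"

definition twist_chi_inv :: "('k::comm_ring_1, 'h::ring_1) hopf \<Rightarrow> 'h tensor2 \<Rightarrow> 'h"
  where "twist_chi_inv H F = (THE y. twist_chi H F * y = 1 \<and> y * twist_chi H F = 1)"

definition twisted :: "('k::comm_ring_1, 'h::ring_1) hopf \<Rightarrow> 'h tensor2 \<Rightarrow> ('k, 'h) hopf"
  where "twisted H F = H\<lparr>
    coprod := (\<lambda>\<xi>. tmult2 (hscale H) (tmult2 (hscale H) F (coprod H \<xi>)) (inverse2 (hscale H) F)),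
    antipode := (\<lambda>\<xi>. twist_chi H F * antipode H \<xi> * twist_chi_inv H F)\<rparr>"


section \<open>Module algebras, bimodules and bimodule algebras\<close>

record ('k, 'h, 'e) hmod =
  scale :: "'k \<Rightarrow> 'e \<Rightarrow> 'e"
  act :: "'h \<Rightarrow> 'e \<Rightarrow> 'e"

record ('k, 'h, 'e) halg = "('k, 'h, 'e) hmod" +
  amult :: "'e \<Rightarrow> 'e \<Rightarrow> 'e"
  aunit :: 'e

record ('k, 'h, 'a, 'e) hbimod = "('k, 'h, 'e) hmod" +
  lmul :: "'a \<Rightarrow> 'e \<Rightarrow> 'e"
  rmul :: "'e \<Rightarrow> 'a \<Rightarrow> 'e"

record ('k, 'h, 'a, 'e) hbimod_alg = "('k, 'h, 'a, 'e) hbimod" +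
  emult :: "'e \<Rightarrow> 'e \<Rightarrow> 'e"
  eunit :: 'e

definition halg_of :: "('k, 'h, 'a, 'e) hbimod_alg \<Rightarrow> ('k, 'h, 'e) halg"
  where "halg_of X = \<lparr>scale = scale X, act = act X, amult = emult X, aunit = eunit X\<rparr>"

text \<open>
  As for algebras, the \<open>\<bbbK>\<close>-module underlying each of the following structures is a submodule \<open>E\<close> of
  the module type. A proper submodule occurs only for algebras of endomorphisms of \<open>V\<close>, inside the
  functions \<open>'v \<Rightarrow> 'v\<close> with pointwise operations.
\<close>

locale hmodule_on = module "scale M"
  for E :: "'e::ab_group_add set" and H :: "('k::comm_ring_1, 'h::ring_1) hopf"
    and M :: "('k, 'h, 'e, 'more) hmod_scheme" +
  assumes carrier_subspace: "subspace E"
    and act_closed: "v \<in> E \<Longrightarrow> act M \<xi> v \<in> E"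
    and act_add_left: "v \<in> E \<Longrightarrow> act M (\<xi> + \<eta>) v = act M \<xi> v + act M \<eta> v"
    and act_add_right: "\<lbrakk>v \<in> E; w \<in> E\<rbrakk> \<Longrightarrow> act M \<xi> (v + w) = act M \<xi> v + act M \<xi> w"
    and act_scale_left: "v \<in> E \<Longrightarrow> act M (hscale H k \<xi>) v = scale M k (act M \<xi> v)"
    and act_scale_right: "v \<in> E \<Longrightarrow> act M \<xi> (scale M k v) = scale M k (act M \<xi> v)"
    and act_mult: "v \<in> E \<Longrightarrow> act M (\<xi> * \<eta>) v = act M \<xi> (act M \<eta> v)"
    and act_one: "v \<in> E \<Longrightarrow> act M 1 v = v"

locale module_algebra_on = hmodule_on E H A + algebra_on "scale A" E "amult A" "aunit A"
  for E :: "'a::ab_group_add set" and H :: "('k::comm_ring_1, 'h::ring_1) hopf"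
    and A :: "('k, 'h, 'a) halg" +
  assumes act_amult: "\<lbrakk>a \<in> E; b \<in> E\<rbrakk> \<Longrightarrow>
      act A \<xi> (amult A a b) = lift2 (\<lambda>x y. amult A (act A x a) (act A y b)) (coprod H \<xi>)"
    and act_aunit: "act A \<xi> (aunit A) = scale A (counit H \<xi>) (aunit A)"

abbreviation module_algebra ::
  "('k::comm_ring_1, 'h::ring_1) hopf \<Rightarrow> ('k, 'h, 'a::ab_group_add) halg \<Rightarrow> bool"
  where "module_algebra \<equiv> module_algebra_on UNIV"

text \<open>A left \<open>H\<close>-module \<open>A\<close>-bimodule includes the requirement that \<open>A\<close> is a left \<open>H\<close>-module algebra.\<close>

locale module_bimodule_on = base: module_algebra_on UNIV H A + hmodule_on E H V
  for E :: "'v::ab_group_add set" and H :: "('k::comm_ring_1, 'h::ring_1) hopf"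
    and A :: "('k, 'h, 'a::ab_group_add) halg"
    and V :: "('k, 'h, 'a, 'v, 'more) hbimod_scheme" +
  assumes lmul_closed: "v \<in> E \<Longrightarrow> lmul V a v \<in> E"
    and lmul_add_left: "v \<in> E \<Longrightarrow> lmul V (a + b) v = lmul V a v + lmul V b v"
    and lmul_add_right: "\<lbrakk>v \<in> E; w \<in> E\<rbrakk> \<Longrightarrow> lmul V a (v + w) = lmul V a v + lmul V a w"
    and lmul_scale_left: "v \<in> E \<Longrightarrow> lmul V (scale A k a) v = scale V k (lmul V a v)"
    and lmul_scale_right: "v \<in> E \<Longrightarrow> lmul V a (scale V k v) = scale V k (lmul V a v)"
    and lmul_mult: "v \<in> E \<Longrightarrow> lmul V (amult A a b) v = lmul V a (lmul V b v)"
    and lmul_unit: "v \<in> E \<Longrightarrow> lmul V (aunit A) v = v"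
    and rmul_closed: "v \<in> E \<Longrightarrow> rmul V v a \<in> E"
    and rmul_add_left: "\<lbrakk>v \<in> E; w \<in> E\<rbrakk> \<Longrightarrow> rmul V (v + w) a = rmul V v a + rmul V w a"
    and rmul_add_right: "v \<in> E \<Longrightarrow> rmul V v (a + b) = rmul V v a + rmul V v b"
    and rmul_scale_left: "v \<in> E \<Longrightarrow> rmul V (scale V k v) a = scale V k (rmul V v a)"
    and rmul_scale_right: "v \<in> E \<Longrightarrow> rmul V v (scale A k a) = scale V k (rmul V v a)"
    and rmul_mult: "v \<in> E \<Longrightarrow> rmul V v (amult A a b) = rmul V (rmul V v a) b"
    and rmul_unit: "v \<in> E \<Longrightarrow> rmul V v (aunit A) = v"
    and lmul_rmul: "v \<in> E \<Longrightarrow> rmul V (lmul V a v) b = lmul V a (rmul V v b)"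
    and act_lmul: "v \<in> E \<Longrightarrow>
      act V \<xi> (lmul V a v) = lift2 (\<lambda>x y. lmul V (act A x a) (act V y v)) (coprod H \<xi>)"
    and act_rmul: "v \<in> E \<Longrightarrow>
      act V \<xi> (rmul V v a) = lift2 (\<lambda>x y. rmul V (act V x v) (act A y a)) (coprod H \<xi>)"

abbreviation module_bimodule ::
  "('k::comm_ring_1, 'h::ring_1) hopf \<Rightarrow> ('k, 'h, 'a::ab_group_add) halg
    \<Rightarrow> ('k, 'h, 'a, 'v::ab_group_add) hbimod \<Rightarrow> bool"
  where "module_bimodule \<equiv> module_bimodule_on UNIV"

definition module_bimodule_algebra_on ::
  "'e::ab_group_add set \<Rightarrow> ('k::comm_ring_1, 'h::ring_1) hopf
    \<Rightarrow> ('k, 'h, 'a::ab_group_add) halg \<Rightarrow> ('k, 'h, 'a, 'e) hbimod_alg \<Rightarrow> bool"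
  where "module_bimodule_algebra_on E H A X \<longleftrightarrow>
    module_bimodule_on E H A X \<and> module_algebra_on E H (halg_of X)"

definition module_bimodule_algebra_iso ::
  "('k::comm_ring_1, 'h::ring_1) hopf \<Rightarrow> ('k, 'h, 'a::ab_group_add) halg
    \<Rightarrow> 'e::ab_group_add set \<Rightarrow> ('k, 'h, 'a, 'e) hbimod_alg
    \<Rightarrow> 'f::ab_group_add set \<Rightarrow> ('k, 'h, 'a, 'f) hbimod_alg \<Rightarrow> ('e \<Rightarrow> 'f) \<Rightarrow> bool"
  where "module_bimodule_algebra_iso H A E X E' X' f \<longleftrightarrow>
    module_bimodule_algebra_on E H A X \<and>
    module_bimodule_algebra_on E' H A X' \<and>
    bij_betw f E E' \<and>
    (\<forall>P\<in>E. \<forall>Q\<in>E. f (P + Q) = f P + f Q) \<and>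
    (\<forall>k. \<forall>P\<in>E. f (scale X k P) = scale X' k (f P)) \<and>
    (\<forall>P\<in>E. \<forall>Q\<in>E. f (emult X P Q) = emult X' (f P) (f Q)) \<and>
    f (eunit X) = eunit X' \<and>
    (\<forall>a. \<forall>P\<in>E. f (lmul X a P) = lmul X' a (f P)) \<and>
    (\<forall>a. \<forall>P\<in>E. f (rmul X P a) = rmul X' (f P) a) \<and>
    (\<forall>\<xi>. \<forall>P\<in>E. f (act X \<xi> P) = act X' \<xi> (f P))"


section \<open>Deformation by a twist\<close>

text \<open>The pairing \<open>p\<close> precomposed with the action of \<open>F\<^sup>-\<^sup>1\<close>.\<close>

definition star ::
  "('k::comm_ring_1, 'h::ring_1) hopf \<Rightarrow> 'h tensor2 \<Rightarrow> ('h \<Rightarrow> 'x \<Rightarrow> 'x) \<Rightarrow> ('h \<Rightarrow> 'y \<Rightarrow> 'y)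
    \<Rightarrow> ('x \<Rightarrow> 'y \<Rightarrow> 'z::ab_group_add) \<Rightarrow> 'x \<Rightarrow> 'y \<Rightarrow> 'z"
  where "star H F act1 act2 p x y =
    lift2 (\<lambda>f g. p (act1 f x) (act2 g y)) (inverse2 (hscale H) F)"

definition deform_alg ::
  "('k::comm_ring_1, 'h::ring_1) hopf \<Rightarrow> 'h tensor2 \<Rightarrow> ('k, 'h, 'a::ab_group_add) halg
    \<Rightarrow> ('k, 'h, 'a) halg"
  where "deform_alg H F A = A\<lparr>amult := star H F (act A) (act A) (amult A)\<rparr>"

definition deform_bimod ::
  "('k::comm_ring_1, 'h::ring_1) hopf \<Rightarrow> 'h tensor2 \<Rightarrow> ('k, 'h, 'a::ab_group_add) halg
    \<Rightarrow> ('k, 'h, 'a, 'v::ab_group_add, 'more) hbimod_scheme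
    \<Rightarrow> ('k, 'h, 'a, 'v, 'more) hbimod_scheme"
  where "deform_bimod H F A V = V\<lparr>
    lmul := star H F (act A) (act V) (lmul V),
    rmul := star H F (act V) (act A) (rmul V)\<rparr>"

definition deform_bimod_alg ::
  "('k::comm_ring_1, 'h::ring_1) hopf \<Rightarrow> 'h tensor2 \<Rightarrow> ('k, 'h, 'a::ab_group_add) halg
    \<Rightarrow> ('k, 'h, 'a, 'e::ab_group_add) hbimod_alg \<Rightarrow> ('k, 'h, 'a, 'e) hbimod_alg"
  where "deform_bimod_alg H F A X =
    (deform_bimod H F A X)\<lparr>emult := star H F (act X) (act X) (emult X)\<rparr>"


section \<open>Endomorphisms\<close>

text \<open>The carrier and the operations of \<open>End\<^sub>A(V)\<close>; the action is the adjoint one of \<open>H\<close>.\<close>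

definition End_carrier ::
  "('k::comm_ring_1, 'h, 'a, 'v::ab_group_add) hbimod \<Rightarrow> ('v \<Rightarrow> 'v) set"
  where "End_carrier V =
    {P. module_hom (scale V) (scale V) P \<and> (\<forall>v a. P (rmul V v a) = rmul V (P v) a)}"

definition End_alg ::
  "('k::comm_ring_1, 'h::ring_1) hopf \<Rightarrow> ('k, 'h, 'a, 'v::ab_group_add) hbimod
    \<Rightarrow> ('k, 'h, 'a, 'v \<Rightarrow> 'v) hbimod_alg"
  where "End_alg H V = \<lparr>
    scale = (\<lambda>k P v. scale V k (P v)),
    act = (\<lambda>\<xi> P. lift2 (\<lambda>x y. act V x \<circ> P \<circ> act V (antipode H y)) (coprod H \<xi>)),
    lmul = (\<lambda>a P. lmul V a \<circ> P),
    rmul = (\<lambda>P a. P \<circ> lmul V a),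
    emult = (\<circ>),
    eunit = id\<rparr>"

definition D_map ::
  "('k::comm_ring_1, 'h::ring_1) hopf \<Rightarrow> 'h tensor2 \<Rightarrow> ('k, 'h, 'a, 'v::ab_group_add) hbimod
    \<Rightarrow> ('v \<Rightarrow> 'v) \<Rightarrow> ('v \<Rightarrow> 'v)"
  where "D_map H F V P =
    lift2 (\<lambda>f g. act (End_alg H V) f P \<circ> act V g) (inverse2 (hscale H) F)"

end

theory Submission
  imports Defs
begin

text \<open>
  Evaluation \<open>End\<^sub>A(V) \<otimes> V \<rightarrow> V\<close> is \<open>H\<close>-equivariant for the adjoint action, and \<open>D\<^sub>F(P)\<close> is evaluation
  deformed by \<open>F\<close>. The cocycle condition makes an associativity law between equivariant pairings
  survive deformation. Applied to composition, evaluation and the bimodule structure of \<open>V\<close> this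
  shows that \<open>D\<^sub>F(P)\<close> is right \<open>A\<^sub>\<star>\<close>-linear and that \<open>D\<^sub>F\<close> respects products and bimodule structures.
  A map that is determined by an identity \<open>\<xi>(P v) = (\<xi>\<^sub>1 P)(\<xi>\<^sub>2 v)\<close> can be isolated with the antipode;
  this yields that \<open>D\<^sub>F\<close> intertwines the adjoint actions of \<open>H\<close> and of its twist. Since the twist of
  \<open>H\<close> by \<open>F\<close> is a Hopf algebra whose twist by \<open>F\<^sup>-\<^sup>1\<close> is \<open>H\<close>, the same construction with the
  roles exchanged inverts \<open>D\<^sub>F\<close>.
\<close>

section \<open>Multilinear maps on tensor products\<close>

subsection \<open>A type containing all quotients of free modules\<close>

text \<open>Elements of H \<otimes> H are classes of formal sums, and every operation on them picks
  a representative. Identities between tensors are therefore proved by evaluating multilinear maps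
  on both sides. As HOL has no quantification over types inside a statement, a single target type
  must serve for all test maps.

  The locale \<open>twist_pair\<close> relates the coproducts and counits of \<open>H\<close> and
  \<open>H'\<close>, while each antipode enters only through the Hopf algebra axioms of its own
  side. Hence neither the exchange of \<open>H\<close> and \<open>H'\<close> nor the intertwining
  property involves a computation with \<chi>: all that matters about an antipode there is that it
  cancels a leg of a coproduct. The explicit twisted antipode is met at one place, the verification
  that the twist is a Hopf algebra.

  Bijectivity comes from one statement, that the construction for \<open>G\<close> undoes the one
  for \<open>F\<close>. It is read once for (\<open>H\<close>, \<open>F\<close>) and once for
  (\<open>H'\<close>, \<open>G\<close>); the second reading lands in the right endomorphisms because
  deforming back returns the original records.\<close>

definition module_congruence ::
  "('k::comm_ring_1 \<Rightarrow> 't \<Rightarrow> 't) \<times> ('t list \<Rightarrow> 't list \<Rightarrow> bool) \<Rightarrow> bool"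
  where "module_congruence = (\<lambda>(\<sigma>, R). equivp R \<and>
    (\<forall>t t' u u'. R t t' \<longrightarrow> R u u' \<longrightarrow> R (t @ u) (t' @ u')) \<and>
    (\<forall>t u. R (t @ u) (u @ t)) \<and>
    (\<forall>k t u. R t u \<longrightarrow> R (map (\<sigma> k) t) (map (\<sigma> k) u)) \<and>
    (\<forall>k l x. R [\<sigma> (k + l) x] [\<sigma> k x, \<sigma> l x]) \<and>
    (\<forall>k l x. R [\<sigma> (k * l) x] [\<sigma> k (\<sigma> l x)]) \<and>
    (\<forall>x. R [\<sigma> 1 x] [x]) \<and>
    (\<forall>x. R [\<sigma> 0 x] []))"

context
  fixes i :: "('k::comm_ring_1 \<Rightarrow> 't \<Rightarrow> 't) \<times> ('t list \<Rightarrow> 't list \<Rightarrow> bool)"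
  assumes c: "module_congruence i"
begin

lemma mc_equivp: "equivp (snd i)"
  and mc_append: "snd i t t' \<Longrightarrow> snd i u u' \<Longrightarrow> snd i (t @ u) (t' @ u')"
  and mc_commute: "snd i (t @ u) (u @ t)"
  and mc_map: "snd i t u \<Longrightarrow> snd i (map (fst i k) t) (map (fst i k) u)"
  using c by (auto simp: module_congruence_def split: prod.splits)

lemma mc_refl: "snd i t t"
  using mc_equivp by (simp add: equivp_reflp)

lemma mc_trans: "snd i t u \<Longrightarrow> snd i u v \<Longrightarrow> snd i t v"
  using mc_equivp by (rule equivp_transp)

lemma mc_sym: "snd i t u \<Longrightarrow> snd i u t"
  using mc_equivp by (rule equivp_symp)

text \<open>The scalar laws are demanded on single generators only; a congruence for concatenation
  spreads them to formal sums.\<close>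

lemma mc_list:
  assumes "\<And>x. snd i [f x] [g x]"
  shows "snd i (map f t) (map g t)"
proof (induction t)
  case (Cons x t)
  then show ?case
    using mc_append[OF assms Cons, of x] by simp
qed (simp add: mc_refl)

lemma mc_map_add: "snd i (map (fst i (k + l)) t) (map (fst i k) t @ map (fst i l) t)"
proof (induction t)
  case (Cons x t)
  have "snd i ([fst i (k + l) x] @ map (fst i (k + l)) t) ([fst i k x, fst i l x] @ (map (fst i k) t @ map (fst i l) t))"
    using c Cons by (intro mc_append) (auto simp: module_congruence_def split: prod.splits)
  \<comment> \<open>The two multiples of \<open>x\<close> come out side by side, so the second one
    has to be moved past the block of multiples by \<open>k\<close>.\<close>
  moreover have "snd i (([fst i k x] @ ([fst i l x] @ map (fst i k) t)) @ map (fst i l) t)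
      (([fst i k x] @ (map (fst i k) t @ [fst i l x])) @ map (fst i l) t)"
    by (intro mc_append mc_refl mc_commute)
  ultimately show ?case
    using mc_trans by fastforce
qed (simp add: mc_refl)

lemma mc_map_mult: "snd i (map (fst i (k * l)) t) (map (fst i k) (map (fst i l) t))"
  using mc_list[of "fst i (k * l)" "\<lambda>x. fst i k (fst i l x)" t] c
  by (simp add: module_congruence_def comp_def split: prod.splits)

lemma mc_map_one: "snd i (map (fst i 1) t) t"
  using mc_list[of "fst i 1" "\<lambda>x. x" t] c by (simp add: module_congruence_def split: prod.splits)

lemma mc_map_zero: "snd i (map (fst i 0) t) []"
proof (induction t)
  case (Cons x t)
  then show ?case
    using mc_append[of "[fst i 0 x]" "[]" "map (fst i 0) t" "[]"] c
    by (simp add: module_congruence_def split: prod.splits)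
qed (simp add: mc_refl)

text \<open>Lists have no inverses of their own. Scaling by -1 supplies them, because 1 + (-1) = 0
  and scaling by 0 gives the empty sum.\<close>

lemma mc_minus: "snd i (t @ map (fst i (- 1)) t) []"
proof -
  have "snd i (map (fst i (1 + (- 1))) t) (map (fst i 1) t @ map (fst i (- 1)) t)"
    by (rule mc_map_add)
  moreover have "snd i (map (fst i 1) t @ map (fst i (- 1)) t) (t @ map (fst i (- 1)) t)"
    by (intro mc_append mc_map_one mc_refl)
  moreover have "snd i (map (fst i (1 + (- 1))) t) []"
    using mc_map_zero by simp
  ultimately show ?thesis
    using mc_trans mc_sym by blast
qed

end

text \<open>
  The quotient of the free module on \<open>'t\<close> by a congruence depends on a term, so it is not a type.
  The product of these quotients over all congruences is a type, and every quotient embeds into it.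
  So multilinear maps into this one type detect equality of tensors.
\<close>

quotient_type (overloaded) ('k, 't) quotients =
  "('k::comm_ring_1 \<Rightarrow> 't \<Rightarrow> 't) \<times> ('t list \<Rightarrow> 't list \<Rightarrow> bool) \<Rightarrow> 't list" /
  "\<lambda>g h. \<forall>i. module_congruence i \<longrightarrow> snd i (g i) (h i)"
proof (rule equivpI)
  show "reflp (\<lambda>g h. \<forall>i. module_congruence i \<longrightarrow> snd i (g i) (h i))"
    unfolding reflp_def by (intro allI impI, erule mc_refl)
  show "symp (\<lambda>g h. \<forall>i. module_congruence i \<longrightarrow> snd i (g i) (h i))"
    unfolding symp_def by (intro allI impI, rule mc_sym; blast)
  show "transp (\<lambda>g h. \<forall>i. module_congruence i \<longrightarrow> snd i (g i) (h i))"
    unfolding transp_def by (intro allI impI, rule mc_trans; blast)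
qed

instantiation quotients :: (comm_ring_1, type) ab_group_add
begin

lift_definition zero_quotients :: "('a, 'b) quotients" is "\<lambda>i. []" .

lift_definition plus_quotients :: "('a, 'b) quotients \<Rightarrow> ('a, 'b) quotients \<Rightarrow> ('a, 'b) quotients"
  is "\<lambda>g h i. g i @ h i"
  by (rule mc_append; blast)

lift_definition uminus_quotients :: "('a, 'b) quotients \<Rightarrow> ('a, 'b) quotients"
  is "\<lambda>g i. map (fst i (- 1)) (g i)"
  by (rule mc_map; blast)

definition minus_quotients :: "('a, 'b) quotients \<Rightarrow> ('a, 'b) quotients \<Rightarrow> ('a, 'b) quotients"
  where "minus_quotients g h = g + (- h)"

instance
proof
  fix a b c :: "('a, 'b) quotients"
  show "a + b + c = a + (b + c)"
    by transfer (intro allI impI, simp, erule mc_refl)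
  show comm: "a + b = b + a" for a b :: "('a, 'b) quotients"
    by transfer (intro allI impI, simp, erule mc_commute)
  show "0 + a = a"
    by transfer (intro allI impI, simp, erule mc_refl)
  have "a + - a = 0"
    by transfer (intro allI impI, simp, erule mc_minus)
  then show "- a + a = 0"
    by (simp add: comm)
  show "a - b = a + - b"
    by (simp add: minus_quotients_def)
qed

end

lift_definition qscale :: "'k::comm_ring_1 \<Rightarrow> ('k, 't) quotients \<Rightarrow> ('k, 't) quotients"
  is "\<lambda>k g i. map (fst i k) (g i)"
  by (rule mc_map; blast)

text \<open>The inclusion of the quotient with index \<open>i\<close> as one coordinate of the
  product; all other coordinates hold the empty sum, that is, zero.\<close>

lift_definition qclass :: "('k::comm_ring_1 \<Rightarrow> 't \<Rightarrow> 't) \<times> ('t list \<Rightarrow> 't list \<Rightarrow> bool)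
    \<Rightarrow> 't list \<Rightarrow> ('k, 't) quotients"
  is "\<lambda>i t j. if i = j then t else []" .

lemma module_qscale: "module qscale"
proof
  fix a b :: "'k::comm_ring_1" and x y :: "('k::comm_ring_1, 't) quotients"
  show "qscale a (x + y) = qscale a x + qscale a y"
    by transfer (intro allI impI, simp, erule mc_refl)
  show "qscale (a + b) x = qscale a x + qscale b x"
    by transfer (intro allI impI, simp, erule mc_map_add)
  show "qscale a (qscale b x) = qscale (a * b) x"
    by transfer (intro allI impI, rule mc_sym, assumption, erule mc_map_mult)
  show "qscale 1 x = x"
    by transfer (intro allI impI, simp, erule mc_map_one)
qed

lemma qclass_append: "qclass i (t @ u) = qclass i t + qclass i u"
  by transfer (simp add: mc_refl del: split_paired_All)

lemma qclass_Nil: "qclass i [] = 0"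
  by transfer (simp add: mc_refl del: split_paired_All)

lemma qscale_qclass: "qscale k (qclass i t) = qclass i (map (fst i k) t)"
  by transfer (simp add: mc_refl del: split_paired_All)

lemma qclass_eq_iff:
  assumes c: "module_congruence i"
  shows "qclass i t = qclass i u \<longleftrightarrow> snd i t u"
proof (transfer fixing: i t u, rule iffI)
  assume "\<forall>j. module_congruence j \<longrightarrow> snd j (if i = j then t else []) (if i = j then u else [])"
  from this[rule_format, OF c] show "snd i t u"
    by simp
next
  assume "snd i t u"
  then show "\<forall>j. module_congruence j \<longrightarrow> snd j (if i = j then t else []) (if i = j then u else [])"
    by (auto simp: mc_refl simp del: split_paired_All)
qed

lemma sum_list_qclass: "(\<Sum>x\<leftarrow>t. qclass i [x]) = qclass i t"
proof (induction t)
  case (Cons x t)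
  then show ?case
    using qclass_append[of i "[x]" t] by simp
qed (simp add: qclass_Nil)


subsection \<open>Bilinear and trilinear maps\<close>

definition bilinear_map ::
  "('k::comm_ring_1 \<Rightarrow> 'h::ab_group_add \<Rightarrow> 'h) \<Rightarrow> ('k \<Rightarrow> 'c::ab_group_add \<Rightarrow> 'c)
    \<Rightarrow> ('h \<Rightarrow> 'h \<Rightarrow> 'c) \<Rightarrow> bool"
  where "bilinear_map s t \<beta> \<longleftrightarrow>
    (\<forall>y. module_hom s t (\<lambda>x. \<beta> x y)) \<and> (\<forall>x. module_hom s t (\<lambda>y. \<beta> x y))"

definition trilinear_map ::
  "('k::comm_ring_1 \<Rightarrow> 'h::ab_group_add \<Rightarrow> 'h) \<Rightarrow> ('k \<Rightarrow> 'c::ab_group_add \<Rightarrow> 'c)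
    \<Rightarrow> ('h \<Rightarrow> 'h \<Rightarrow> 'h \<Rightarrow> 'c) \<Rightarrow> bool"
  where "trilinear_map s t \<gamma> \<longleftrightarrow>
    (\<forall>y z. module_hom s t (\<lambda>x. \<gamma> x y z)) \<and> (\<forall>x z. module_hom s t (\<lambda>y. \<gamma> x y z)) \<and>
    (\<forall>x y. module_hom s t (\<lambda>z. \<gamma> x y z))"

text \<open>Most of these rules are stated for a composite with an arbitrary linear map
  \<open>g\<close>, so that resolution can work through nested terms. They discharge the
  multilinearity conditions that accompany every change of representative.\<close>

named_theorems linear_intros

lemma bilinear_mapI [linear_intros]:
  assumes "\<And>y. module_hom s t (\<lambda>x. \<beta> x y)" "\<And>x. module_hom s t (\<lambda>y. \<beta> x y)"
  shows "bilinear_map s t \<beta>"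
  using assms by (simp add: bilinear_map_def)

lemma bilinear_mapD:
  assumes "bilinear_map s t \<beta>"
  shows "module_hom s t (\<lambda>x. \<beta> x y)" "module_hom s t (\<lambda>y. \<beta> x y)"
  using assms by (simp_all add: bilinear_map_def)

lemma trilinear_mapI [linear_intros]:
  assumes "\<And>y z. module_hom s t (\<lambda>x. \<gamma> x y z)" "\<And>x z. module_hom s t (\<lambda>y. \<gamma> x y z)"
    "\<And>x y. module_hom s t (\<lambda>z. \<gamma> x y z)"
  shows "trilinear_map s t \<gamma>"
  using assms by (simp add: trilinear_map_def)

lemma trilinear_mapD:
  assumes "trilinear_map s t \<gamma>"
  shows "module_hom s t (\<lambda>x. \<gamma> x y z)" "module_hom s t (\<lambda>y. \<gamma> x y z)"
    "module_hom s t (\<lambda>z. \<gamma> x y z)"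
  using assms by (simp_all add: trilinear_map_def)

lemma module_hom_comp:
  assumes "module_hom s t g" "module_hom t r f"
  shows "module_hom s r (\<lambda>x. f (g x))"
  using module_hom_compose[OF assms] by (simp add: comp_def)

lemma bilinear_map_compose:
  assumes "bilinear_map s t \<beta>" "module_hom r s g"
  shows "module_hom r t (\<lambda>x. \<beta> (g x) y)" "module_hom r t (\<lambda>x. \<beta> y (g x))"
  using assms by (auto intro: module_hom_comp bilinear_mapD)

lemma trilinear_map_compose:
  assumes "trilinear_map s t \<gamma>" "module_hom r s g"
  shows "module_hom r t (\<lambda>x. \<gamma> (g x) y z)" "module_hom r t (\<lambda>x. \<gamma> y (g x) z)"
    "module_hom r t (\<lambda>x. \<gamma> y z (g x))"
  using assms by (auto intro: module_hom_comp trilinear_mapD)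

lemma module_hom_idI [linear_intros]: "module s \<Longrightarrow> module_hom s s (\<lambda>x. x)"
  by (simp add: module_hom_iff)

lemma module_hom_addI [linear_intros]:
  assumes "module_hom s t f" "module_hom s t g"
  shows "module_hom s t (\<lambda>x. f x + g x)"
proof -
  interpret f: module_hom s t f by fact
  interpret g: module_hom s t g by fact
  show ?thesis
    by unfold_locales (simp_all add: f.add g.add f.scale g.scale f.m2.scale_right_distrib)
qed

lemma module_hom_diffI [linear_intros]:
  assumes "module_hom s t f" "module_hom s t g"
  shows "module_hom s t (\<lambda>x. f x - g x)"
proof -
  interpret f: module_hom s t f by fact
  interpret g: module_hom s t g by fact
  show ?thesis
    by unfold_locales (simp_all add: f.add g.add f.scale g.scale f.m2.scale_right_diff_distrib)
qed

section \<open>Triple tensors and the detection of tensor equality\<close>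

definition tensors3 :: "('k::comm_ring_1 \<Rightarrow> 'h::ab_group_add \<Rightarrow> 'h) \<Rightarrow> 'h tensor3 set"
  where "tensors3 s = range (cls3 s)"

definition lift3 :: "('h \<Rightarrow> 'h \<Rightarrow> 'h \<Rightarrow> 'c::ab_group_add) \<Rightarrow> 'h tensor3 \<Rightarrow> 'c"
  where "lift3 \<gamma> T = (\<Sum>(x, y, z) \<leftarrow> rep T. \<gamma> x y z)"

lemma rep_cls3: "teq3 s t (rep (cls3 s t))"
proof -
  have "rep (cls3 s t) \<in> cls3 s t"
    unfolding rep_def by (rule someI[of _ t]) (simp add: cls3_def teq3.refl)
  then show ?thesis
    by (simp add: cls3_def)
qed

lemma cls2_eq_iff: "cls2 s t = cls2 s u \<longleftrightarrow> teq2 s t u"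
  unfolding cls2_def by (auto intro: teq2.refl teq2.sym teq2.trans)

lemma cls3_eq_iff: "cls3 s t = cls3 s u \<longleftrightarrow> teq3 s t u"
  unfolding cls3_def by (auto intro: teq3.refl teq3.sym teq3.trans)

lemma lift2_cls2_bilinear:
  assumes "bilinear_map s t \<beta>"
  shows "lift2 \<beta> (cls2 s xs) = (\<Sum>(x, y) \<leftarrow> xs. \<beta> x y)"
  by (rule lift2_cls2)
    (simp_all add: bilinear_mapD[OF assms, THEN module_hom.add] bilinear_mapD[OF assms, THEN module_hom.scale])

lemma lift3_cls3:
  assumes "trilinear_map s t \<gamma>"
  shows "lift3 \<gamma> (cls3 s xs) = (\<Sum>(x, y, z) \<leftarrow> xs. \<gamma> x y z)"
proof -
  note lin = trilinear_mapD[OF assms]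
  have "teq3 s t u \<Longrightarrow> (\<Sum>(x, y, z) \<leftarrow> t. \<gamma> x y z) = (\<Sum>(x, y, z) \<leftarrow> u. \<gamma> x y z)" for t u
    by (induction rule: teq3.induct)
      (simp_all add: lin[THEN module_hom.add] lin[THEN module_hom.scale] lin(1)[THEN module_hom.zero]
        add.commute)
  from this[OF rep_cls3] show ?thesis
    by (simp add: lift3_def)
qed

text \<open>Scalars act on the left factor. Compatibility with the balancing relation rests on the
  commutativity of the scalars: \<open>k\<close> and \<open>l\<close> are exchanged before
  \<open>l\<close> is moved to the right factor.\<close>

lemma module_congruence_teq2:
  assumes "module s"
  shows "module_congruence (\<lambda>k (x, y). (s k x, y), teq2 s)"
proof -
  interpret module s by fact
  have "teq2 s (map (\<lambda>(x, y). (s k x, y)) t) (map (\<lambda>(x, y). (s k x, y)) u)"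
    if "teq2 s t u" for k t u
    using that
  proof (induction rule: teq2.induct)
    case (balanced l x y)
    then show ?case
      using teq2.balanced[of s l "s k x" y] by (simp add: mult.commute)
  qed (auto intro: teq2.intros simp: scale_right_distrib)
  moreover have "equivp (teq2 s)"
    by (rule equivpI) (auto simp: reflp_def symp_def transp_def intro: teq2.refl teq2.sym teq2.trans)
  ultimately show ?thesis
    by (auto simp: module_congruence_def scale_left_distrib intro: teq2.intros)
qed

lemma module_congruence_teq3:
  assumes "module s"
  shows "module_congruence (\<lambda>k (x, y, z). (s k x, y, z), teq3 s)"
proof -
  interpret module s by fact
  have "teq3 s (map (\<lambda>(x, y, z). (s k x, y, z)) t) (map (\<lambda>(x, y, z). (s k x, y, z)) u)"
    if "teq3 s t u" for k t u
    using that
  proof (induction rule: teq3.induct)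
    case (balanced12 l x y z)
    then show ?case
      using teq3.balanced12[of s l "s k x" y z] by (simp add: mult.commute)
  qed (auto intro: teq3.intros simp: scale_right_distrib)
  moreover have "equivp (teq3 s)"
    by (rule equivpI) (auto simp: reflp_def symp_def transp_def intro: teq3.refl teq3.sym teq3.trans)
  ultimately show ?thesis
    by (auto simp: module_congruence_def scale_left_distrib intro: teq3.intros)
qed

text \<open>The decisive test map is the universal one, sending (x, y) to the class of x \<otimes> y
  in the coordinate of \<open>teq2 s\<close>. The last two facts offered about \<beta> restate
  bilinearity for composites, in the form in which the simplifier meets it.\<close>

lemma tensor2_eqI:
  fixes s :: "'k::comm_ring_1 \<Rightarrow> 'h::ab_group_add \<Rightarrow> 'h"
  assumes s: "module s" and T: "T \<in> tensors2 s" and U: "U \<in> tensors2 s"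
    and eq: "\<And>\<beta> :: 'h \<Rightarrow> 'h \<Rightarrow> ('k, 'h \<times> 'h) quotients. 
      \<lbrakk>bilinear_map s qscale \<beta>;
       \<And>g y. module_hom s s g \<Longrightarrow> module_hom s qscale (\<lambda>x. \<beta> (g x) y);
       \<And>g y. module_hom s s g \<Longrightarrow> module_hom s qscale (\<lambda>x. \<beta> y (g x))\<rbrakk>
      \<Longrightarrow> lift2 \<beta> T = lift2 \<beta> U"
  shows "T = U"
proof -
  interpret module s by fact
  define i where "i = (\<lambda>k (x :: 'h, y :: 'h). (s k x, y), teq2 s)"
  have i: "module_congruence i"
    unfolding i_def by (rule module_congruence_teq2[OF s])
  define \<beta> where "\<beta> = (\<lambda>x y. qclass i [(x, y)])"
  obtain t u where tu: "T = cls2 s t" "U = cls2 s u"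
    using T U by (auto simp: tensors2_def)
  have cls: "qclass i t = qclass i u" if "teq2 s t u" for t u
    using that qclass_eq_iff[OF i] by (simp add: i_def)
  have lin: "bilinear_map s qscale \<beta>"
  proof (intro bilinear_mapI; unfold_locales)
    fix x x' y k
    show "\<beta> (x + x') y = \<beta> x y + \<beta> x' y"
      unfolding \<beta>_def using cls[OF teq2.add_left] by (simp flip: qclass_append)
    show "\<beta> x (y + x') = \<beta> x y + \<beta> x x'" for x y x'
      unfolding \<beta>_def using cls[OF teq2.add_right] by (simp flip: qclass_append)
    show "\<beta> (s k x) y = qscale k (\<beta> x y)"
      unfolding \<beta>_def i_def by (simp add: qscale_qclass)
    show "\<beta> x (s k y) = qscale k (\<beta> x y)" for x y
      using cls[OF teq2.balanced] unfolding \<beta>_def i_def by (simp add: qscale_qclass)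
  qed (simp_all add: scale_right_distrib scale_left_distrib module.scale_right_distrib[OF module_qscale]
      module.scale_left_distrib[OF module_qscale] module.scale_scale[OF module_qscale] module.scale_one[OF module_qscale])
  have "lift2 \<beta> (cls2 s t) = qclass i t" for t
    using lin by (simp add: lift2_cls2_bilinear \<beta>_def split_def sum_list_qclass)
  then show ?thesis
    using eq[OF lin bilinear_map_compose[OF lin]] qclass_eq_iff[OF i] by (simp add: tu cls2_eq_iff i_def)
qed

lemma tensor3_eqI:
  fixes s :: "'k::comm_ring_1 \<Rightarrow> 'h::ab_group_add \<Rightarrow> 'h"
  assumes s: "module s" and T: "T \<in> tensors3 s" and U: "U \<in> tensors3 s"
    and eq: "\<And>\<gamma> :: 'h \<Rightarrow> 'h \<Rightarrow> 'h \<Rightarrow> ('k, 'h \<times> 'h \<times> 'h) quotients.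

      \<lbrakk>trilinear_map s qscale \<gamma>;
       \<And>g y z. module_hom s s g \<Longrightarrow> module_hom s qscale (\<lambda>x. \<gamma> (g x) y z);
       \<And>g y z. module_hom s s g \<Longrightarrow> module_hom s qscale (\<lambda>x. \<gamma> y (g x) z);
       \<And>g y z. module_hom s s g \<Longrightarrow> module_hom s qscale (\<lambda>x. \<gamma> y z (g x))\<rbrakk>
      \<Longrightarrow> lift3 \<gamma> T = lift3 \<gamma> U"
  shows "T = U"
proof -
  interpret module s by fact
  define i where "i = (\<lambda>k (x :: 'h, y :: 'h, z :: 'h). (s k x, y, z), teq3 s)"
  have i: "module_congruence i"
    unfolding i_def by (rule module_congruence_teq3[OF s])
  define \<gamma> where "\<gamma> = (\<lambda>x y z. qclass i [(x, y, z)])"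
  obtain t u where tu: "T = cls3 s t" "U = cls3 s u"
    using T U by (auto simp: tensors3_def)
  have cls: "qclass i t = qclass i u" if "teq3 s t u" for t u
    using that qclass_eq_iff[OF i] by (simp add: i_def)
  have lin: "trilinear_map s qscale \<gamma>"
  proof (intro trilinear_mapI; unfold_locales)
    fix x x' y z k
    show "\<gamma> (x + x') y z = \<gamma> x y z + \<gamma> x' y z"
      unfolding \<gamma>_def using cls[OF teq3.add1] by (simp flip: qclass_append)
    show "\<gamma> x (y + x') z = \<gamma> x y z + \<gamma> x x' z" for x y x'
      unfolding \<gamma>_def using cls[OF teq3.add2] by (simp flip: qclass_append)
    show "\<gamma> x y (z + x') = \<gamma> x y z + \<gamma> x y x'" for x y z x'
      unfolding \<gamma>_def using cls[OF teq3.add3] by (simp flip: qclass_append)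
    show "\<gamma> (s k x) y z = qscale k (\<gamma> x y z)"
      unfolding \<gamma>_def i_def by (simp add: qscale_qclass)
    show bal: "\<gamma> x (s k y) z = qscale k (\<gamma> x y z)" for x y
      using cls[OF teq3.balanced12] unfolding \<gamma>_def i_def by (simp add: qscale_qclass)
    show "\<gamma> x y (s k z) = qscale k (\<gamma> x y z)" for x y z
      using cls[OF teq3.balanced23, of x k y z] bal[of x y] cls[OF teq3.balanced12, of k x y z]
      unfolding \<gamma>_def i_def by (simp add: qscale_qclass)
  qed (simp_all add: scale_right_distrib scale_left_distrib module.scale_right_distrib[OF module_qscale]
      module.scale_left_distrib[OF module_qscale] module.scale_scale[OF module_qscale] module.scale_one[OF module_qscale])
  have "lift3 \<gamma> (cls3 s t) = qclass i t" for t
    using lin by (simp add: lift3_cls3 \<gamma>_def split_def sum_list_qclass)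
  then show ?thesis
    using eq[OF lin trilinear_map_compose[OF lin]] qclass_eq_iff[OF i] by (simp add: tu cls3_eq_iff i_def)
qed


section \<open>Calculus of maps induced on tensors\<close>

lemma sum_list_swap:
  "(\<Sum>x\<leftarrow>xs. \<Sum>y\<leftarrow>ys. f x y) = (\<Sum>y\<leftarrow>ys. \<Sum>x\<leftarrow>xs. f x y :: 'c::comm_monoid_add)"
  by (induction xs) (simp_all add: sum_list_addf)

lemma sum_list_map_concat:
  "(\<Sum>x\<leftarrow>concat xss. f x) = (\<Sum>xs\<leftarrow>xss. \<Sum>x\<leftarrow>xs. f x :: 'c::comm_monoid_add)"
  by (induction xss) simp_all

text \<open>\<open>lift2\<close> is a sum over one chosen representative, so an additive map passes
  through it term by term, with both sides using the same representative. The carrier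
  \<open>E\<close> accommodates maps that are additive on a submodule, as for endomorphism
  algebras.\<close>

lemma lift2_hom_on:
  assumes t: "module t" "module.subspace t E"
    and h: "\<And>a b. a \<in> E \<Longrightarrow> b \<in> E \<Longrightarrow> h (a + b) = h a + h b"
    and \<beta>: "\<And>x y. \<beta> x y \<in> E"
  shows "h (lift2 \<beta> T) = lift2 (\<lambda>x y. h (\<beta> x y)) T"
proof -
  interpret module t by fact
  have 0: "0 \<in> E"
    by (rule subspace_0[OF t(2)])
  have "h 0 = 0"
    using h[OF 0 0] by simp
  moreover have "(\<Sum>(x, y)\<leftarrow>xs. \<beta> x y) \<in> E" for xs
    by (induction xs) (auto intro: 0 subspace_add[OF t(2)] \<beta>)
  ultimately have "h (\<Sum>(x, y)\<leftarrow>xs. \<beta> x y) = (\<Sum>(x, y)\<leftarrow>xs. h (\<beta> x y))" for xs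
    by (induction xs) (auto simp: h \<beta>)
  then show ?thesis
    by (simp add: lift2_def)
qed

lemma lift2_mem:
  assumes t: "module t" "module.subspace t E" and \<beta>: "\<And>x y. \<beta> x y \<in> E"
  shows "lift2 \<beta> T \<in> E"
proof -
  interpret module t by fact
  have "(\<Sum>(x, y)\<leftarrow>xs. \<beta> x y) \<in> E" for xs
    by (induction xs) (auto intro: subspace_0[OF t(2)] subspace_add[OF t(2)] \<beta>)
  then show ?thesis
    by (simp add: lift2_def)
qed

lemma lift2_hom:
  assumes "module_hom t r h"
  shows "h (lift2 \<beta> T) = lift2 (\<lambda>x y. h (\<beta> x y)) T"
proof -
  interpret module_hom t r h by fact
  show ?thesis
    by (rule lift2_hom_on[of t UNIV]) (simp_all add: m1.module_axioms add)
qed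

text \<open>An interchange of two finite sums, each over a fixed representative. It is legitimate
  when neither tensor depends on the legs of the other.\<close>

lemma lift2_swap:
  "lift2 (\<lambda>x y. lift2 (\<lambda>a b. \<beta> x y a b) U) T = lift2 (\<lambda>a b. lift2 (\<lambda>x y. \<beta> x y a b) T) U"
  unfolding lift2_def split_def by (rule sum_list_swap)

lemma lift2_apply: "lift2 \<beta> T v = lift2 (\<lambda>x y. \<beta> x y v) T"
proof -
  have "(\<Sum>(x, y)\<leftarrow>xs. \<beta> x y) v = (\<Sum>(x, y)\<leftarrow>xs. \<beta> x y v)" for xs
    by (induction xs) auto
  then show ?thesis
    by (simp add: lift2_def)
qed

lemma lift2_add: "lift2 (\<lambda>x y. \<beta> x y + \<beta>' x y) T = lift2 \<beta> T + lift2 \<beta>' T"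
  by (simp add: lift2_def split_def sum_list_addf)

lemma lift2_diff:
  "lift2 (\<lambda>x y. \<beta> x y - \<beta>' x y) T = lift2 \<beta> T - lift2 \<beta>' T"
  by (simp add: lift2_def split_def sum_list_subtractf)

lemma lift2_0: "lift2 (\<lambda>x y. 0) T = 0"
  by (simp add: lift2_def split_def)

lemma module_hom_lift2 [linear_intros]:
  assumes "\<And>a b. module_hom s t (\<lambda>x. \<beta> x a b)"
  shows "module_hom s t (\<lambda>x. lift2 (\<lambda>a b. \<beta> x a b) T)"
proof -
  interpret module_hom s t "\<lambda>x. \<beta> x undefined undefined" by (rule assms)
  show ?thesis
    using assms[THEN module_hom.add] assms[THEN module_hom.scale]
    by unfold_locales (simp_all add: lift2_add lift2_hom[OF m2.module_hom_scale_self])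
qed

lemma cls2_in_tensors2 [simp]: "cls2 s t \<in> tensors2 s"
  by (simp add: tensors2_def)

lemma cls3_in_tensors3 [simp]: "cls3 s t \<in> tensors3 s"
  by (simp add: tensors3_def)

lemma tensor_ops_closed [simp]:
  "tadd2 s T U \<in> tensors2 s" "tscale2 s k T \<in> tensors2 s" "tone2 r \<in> tensors2 r" "tmult2 r T U \<in> tensors2 r"
  "tmult3 r X Y \<in> tensors3 r" "tensor_one r T \<in> tensors3 r" "one_tensor r T \<in> tensors3 r"
  "map_left s \<Delta> T \<in> tensors3 s" "map_right s \<Delta> T \<in> tensors3 s"
  by (simp_all add: tadd2_def tscale2_def tone2_def tmult2_def tmult3_def tensor_one_def one_tensor_def
      map_left_def map_right_def)

text \<open>Here bilinearity is essential: the operations form a new class, whose chosen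
  representative may differ from the list that it was built from.\<close>

lemma
  assumes "bilinear_map s t \<beta>"
  shows lift2_tadd2: "lift2 \<beta> (tadd2 s T U) = lift2 \<beta> T + lift2 \<beta> U"
    and lift2_tscale2: "lift2 \<beta> (tscale2 s k T) = t k (lift2 \<beta> T)"
proof -
  show "lift2 \<beta> (tadd2 s T U) = lift2 \<beta> T + lift2 \<beta> U"
    by (simp add: tadd2_def lift2_cls2_bilinear[OF assms]) (simp add: lift2_def)
  interpret module_hom s t "\<lambda>x. \<beta> x undefined" by (rule bilinear_mapD[OF assms])
  have "lift2 \<beta> (tscale2 s k T) = lift2 (\<lambda>x y. \<beta> (s k x) y) T"
    by (simp add: tscale2_def lift2_cls2_bilinear[OF assms] comp_def split_def) (simp add: lift2_def split_def)
  then show "lift2 \<beta> (tscale2 s k T) = t k (lift2 \<beta> T)"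
    by (simp add: bilinear_mapD[OF assms, THEN module_hom.scale] lift2_hom[OF m2.module_hom_scale_self])
qed

lemma
  assumes "bilinear_map s t \<beta>"
  shows lift2_tmult2: "lift2 \<beta> (tmult2 s T U) = lift2 (\<lambda>x y. lift2 (\<lambda>x' y'. \<beta> (x * x') (y * y')) U) T"
    and lift2_tone2: "lift2 \<beta> (tone2 s) = \<beta> 1 1"
  by (simp add: tmult2_def lift2_cls2_bilinear[OF assms] split_def comp_def sum_list_map_concat,
      simp add: lift2_def split_def, simp add: tone2_def lift2_cls2_bilinear[OF assms])

lemma
  assumes "trilinear_map s t \<gamma>"
  shows lift3_tmult3: "lift3 \<gamma> (tmult3 s X Y) =
      lift3 (\<lambda>x y z. lift3 (\<lambda>x' y' z'. \<gamma> (x * x') (y * y') (z * z')) Y) X"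
    and lift3_tensor_one: "lift3 \<gamma> (tensor_one s T) = lift2 (\<lambda>x y. \<gamma> x y 1) T"
    and lift3_one_tensor: "lift3 \<gamma> (one_tensor s T) = lift2 (\<lambda>x y. \<gamma> 1 x y) T"
  by (simp_all add: tmult3_def tensor_one_def one_tensor_def lift3_cls3[OF assms] split_def comp_def
      sum_list_map_concat) (simp_all add: lift2_def lift3_def split_def)

lemma
  assumes "trilinear_map s t \<gamma>"
  shows lift3_map_left: "lift3 \<gamma> (map_left s \<Delta> T) = lift2 (\<lambda>x y. lift2 (\<lambda>x\<^sub>1 x\<^sub>2. \<gamma> x\<^sub>1 x\<^sub>2 y) (\<Delta> x)) T"
    and lift3_map_right: "lift3 \<gamma> (map_right s \<Delta> T) = lift2 (\<lambda>x y. lift2 (\<lambda>y\<^sub>1 y\<^sub>2. \<gamma> x y\<^sub>1 y\<^sub>2) (\<Delta> y)) T"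
  by (simp_all add: map_left_def map_right_def lift3_cls3[OF assms] split_def comp_def
      sum_list_map_concat) (simp_all add: lift2_def lift3_def split_def)

lemma lift3_add: "lift3 (\<lambda>x y z. \<gamma> x y z + \<gamma>' x y z) T = lift3 \<gamma> T + lift3 \<gamma>' T"
  by (simp add: lift3_def split_def sum_list_addf)

lemma lift3_hom:
  assumes "module_hom t r h"
  shows "h (lift3 \<gamma> T) = lift3 (\<lambda>x y z. h (\<gamma> x y z)) T"
proof -
  interpret module_hom t r h by fact
  have "h (\<Sum>(x, y, z)\<leftarrow>xs. \<gamma> x y z) = (\<Sum>(x, y, z)\<leftarrow>xs. h (\<gamma> x y z))" for xs
    by (induction xs) (auto simp: add)
  then show ?thesis
    by (simp add: lift3_def)
qed

lemma module_hom_lift3 [linear_intros]: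
  assumes "\<And>a b c. module_hom s t (\<lambda>x. \<gamma> x a b c)"
  shows "module_hom s t (\<lambda>x. lift3 (\<lambda>a b c. \<gamma> x a b c) T)"
proof -
  interpret module_hom s t "\<lambda>x. \<gamma> x undefined undefined undefined" by (rule assms)
  show ?thesis
    using assms[THEN module_hom.add] assms[THEN module_hom.scale]
    by unfold_locales (simp_all add: lift3_add lift3_hom[OF m2.module_hom_scale_self])
qed


section \<open>Algebras on tensor powers\<close>

locale k_algebra = algebra_on s UNIV "(*)" 1
  for s :: "'k::comm_ring_1 \<Rightarrow> 'h::ring_1 \<Rightarrow> 'h"
begin

lemma mult_hom [linear_intros]:
  assumes "module_hom r s g"
  shows "module_hom r s (\<lambda>x. c * g x)" "module_hom r s (\<lambda>x. g x * c)"
proof -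
  interpret g: module_hom r s g by (rule assms)
  show "module_hom r s (\<lambda>x. c * g x)" "module_hom r s (\<lambda>x. g x * c)"
    by unfold_locales (simp_all add: g.add g.scale distrib_left distrib_right scale_left scale_right)
qed

lemma self_hom [linear_intros]: "module_hom s s (\<lambda>x. x)"
  by (rule module_hom_idI) (rule module_axioms)

definition tone3 :: "'h tensor3"
  where "tone3 = cls3 s [(1, 1, 1)]"

lemma lift3_tone3: "trilinear_map s t \<gamma> \<Longrightarrow> lift3 \<gamma> tone3 = \<gamma> 1 1 1"
  by (simp add: tone3_def lift3_cls3)

lemma tone3_closed [simp]: "tone3 \<in> tensors3 s"
  by (simp add: tone3_def)

lemmas tensor_eqIs = tensor2_eqI[OF module_axioms] tensor3_eqI[OF module_axioms]

text \<open>Evaluation of test maps on tensor expressions. Together with \<open>tensor_eqIs\<close>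
  it reduces an equation of tensors to an equation of iterated sums with ring expressions as
  arguments.\<close>

lemmas lift_ops =
  lift2_tmult2[where s = s and t = qscale] lift2_tone2[where s = s and t = qscale]
  lift2_tadd2[where s = s and t = qscale] lift2_tscale2[where s = s and t = qscale]
  lift3_tmult3[where s = s and t = qscale] lift3_tone3[where t = qscale]
  lift3_tensor_one[where s = s and t = qscale] lift3_one_tensor[where s = s and t = qscale]
  lift2_add lift2_hom[OF module.module_hom_scale_self, OF module_qscale]

lemma tmult2_assoc: "tmult2 s (tmult2 s T U) W = tmult2 s T (tmult2 s U W)"
  by (rule tensor_eqIs; simp add: lift_ops linear_intros mult.assoc)

lemma tmult2_one:
  assumes "T \<in> tensors2 s"
  shows "tmult2 s (tone2 s) T = T" "tmult2 s T (tone2 s) = T"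
  by (rule tensor_eqIs; simp add: lift_ops linear_intros assms)+

lemma tmult2_tadd2:
  "tmult2 s T (tadd2 s U W) = tadd2 s (tmult2 s T U) (tmult2 s T W)"
  "tmult2 s (tadd2 s U W) T = tadd2 s (tmult2 s U T) (tmult2 s W T)"
  by (rule tensor_eqIs; simp add: lift_ops linear_intros)+

lemma tmult2_tscale2:
  "tmult2 s T (tscale2 s k U) = tscale2 s k (tmult2 s T U)"
  "tmult2 s (tscale2 s k U) T = tscale2 s k (tmult2 s U T)"
  by (rule tensor_eqIs; simp add: lift_ops linear_intros)+

lemma tmult3_assoc: "tmult3 s (tmult3 s T U) W = tmult3 s T (tmult3 s U W)"
  by (rule tensor_eqIs; simp add: lift_ops linear_intros mult.assoc)

lemma tmult3_one:
  assumes "T \<in> tensors3 s"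
  shows "tmult3 s tone3 T = T" "tmult3 s T tone3 = T"
  by (rule tensor_eqIs; simp add: lift_ops linear_intros assms)+

lemma tensor_one_mult: "tensor_one s (tmult2 s T U) = tmult3 s (tensor_one s T) (tensor_one s U)"
  and one_tensor_mult: "one_tensor s (tmult2 s T U) = tmult3 s (one_tensor s T) (one_tensor s U)"
  by (rule tensor_eqIs; simp add: lift_ops linear_intros)+

lemma tensor_one_one: "tensor_one s (tone2 s) = tone3"
  and one_tensor_one: "one_tensor s (tone2 s) = tone3"
  by (rule tensor_eqIs; simp add: lift_ops linear_intros)+

text \<open>Conjugating the coproduct affects only the two legs that it creates. The conjugating
  tensors do not depend on \<open>T\<close>, so they leave the sum over \<open>T\<close> as factors
  extended by 1 in the remaining leg.\<close>

lemma
  fixes \<Delta>' :: "'h \<Rightarrow> 'h tensor2"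
  assumes \<Delta>': "\<And>\<xi>. \<Delta>' \<xi> = tmult2 s (tmult2 s F (\<Delta> \<xi>)) G"
    and \<Delta>: "\<And>t \<beta>. bilinear_map s (qscale :: 'k \<Rightarrow> _ \<Rightarrow> ('k, 'h \<times> 'h \<times> 'h) quotients) \<beta>
      \<Longrightarrow> module_hom s qscale (\<lambda>x. lift2 \<beta> (\<Delta> x))"
  shows map_left_conj:
      "map_left s \<Delta>' T = tmult3 s (tmult3 s (tensor_one s F) (map_left s \<Delta> T)) (tensor_one s G)"
    and map_right_conj:
      "map_right s \<Delta>' T = tmult3 s (tmult3 s (one_tensor s F) (map_right s \<Delta> T)) (one_tensor s G)"
proof -
  note [simp] = lift_ops linear_intros \<Delta> \<Delta>'
    lift3_map_left[where s = s and t = qscale] lift3_map_right[where s = s and t = qscale]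
  show "map_left s \<Delta>' T = tmult3 s (tmult3 s (tensor_one s F) (map_left s \<Delta> T)) (tensor_one s G)"
    \<comment> \<open>What remains is to pull the sum over \<open>F\<close> out of the sum over
      \<open>T\<close>.\<close>
    by (rule tensor_eqIs; simp) (simp only: lift2_swap[where U = F])
  show "map_right s \<Delta>' T = tmult3 s (tmult3 s (one_tensor s F) (map_right s \<Delta> T)) (one_tensor s G)"
    by (rule tensor_eqIs; simp) (simp only: lift2_swap[where U = F])
qed

lemma tmult3_inverse_unique:
  assumes "tmult3 s X Z = tone3" "tmult3 s Z Y = tone3" "X \<in> tensors3 s" "Y \<in> tensors3 s"
  shows "X = Y"
  using tmult3_assoc[of X Z Y] assms by (simp add: tmult3_one)

lemma inverse2_eq:
  assumes "F \<in> tensors2 s" "is_inverse2 s F G"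
  shows "inverse2 s F = G"
  unfolding inverse2_def
proof (rule the_equality)
  fix G' assume G': "is_inverse2 s F G'"
  then have "G' = tmult2 s G' (tmult2 s F G)"
    using assms tmult2_one by (simp add: is_inverse2_def)
  also have "\<dots> = tmult2 s (tmult2 s G' F) G"
    by (rule tmult2_assoc[symmetric])
  also have "\<dots> = G"
    using assms G' tmult2_one by (simp add: is_inverse2_def)
  finally show "G' = G" .
qed (rule assms)

end

section \<open>Hopf algebras\<close>

lemma (in hmodule_on) act_hom [linear_intros]:
  assumes "module_hom r (hscale H) g" "v \<in> E"
  shows "module_hom r (scale M) (\<lambda>x. act M (g x) v)"
proof -
  interpret g: module_hom r "hscale H" g by fact
  show ?thesis
    using assms(2) by unfold_locales (simp_all add: g.add g.scale act_add_left act_scale_left)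
qed

lemma (in hmodule_on) act_hom_right [linear_intros]:
  assumes "module_hom r (scale M) h" "\<And>x. h x \<in> E"
  shows "module_hom r (scale M) (\<lambda>x. act M \<xi> (h x))"
proof -
  interpret h: module_hom r "scale M" h by fact
  show ?thesis
    using assms(2) by unfold_locales (simp_all add: h.add h.scale act_add_right act_scale_right)
qed

lemma (in module) scale_hom [linear_intros]:
  assumes "module_hom r (*) g"
  shows "module_hom r scale (\<lambda>x. scale (g x) v)"
proof -
  interpret g: module_hom r "(*)" g by fact
  show ?thesis
    by unfold_locales (simp_all add: g.add g.scale scale_left_distrib)
qed

lemma (in module) scale_hom_right [linear_intros]:
  assumes "module_hom r scale h"
  shows "module_hom r scale (\<lambda>x. scale k (h x))"
proof -
  interpret h: module_hom r scale h by fact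
  show ?thesis
    by unfold_locales (simp_all add: h.add h.scale scale_right_distrib mult.commute)
qed

context hopf_algebra
begin

abbreviation "s \<equiv> hscale H"
abbreviation "\<Delta> \<equiv> coprod H"
abbreviation "\<epsilon> \<equiv> counit H"
abbreviation "S \<equiv> antipode H"

sublocale alg: k_algebra s
  unfolding k_algebra_def by (rule algebra)

lemma antipode_hom [linear_intros]: "module_hom r s g \<Longrightarrow> module_hom r s (\<lambda>x. S (g x))"
  by (rule module_hom_comp[OF _ antipode_linear])

lemma counit_hom [linear_intros]: "module_hom r s g \<Longrightarrow> module_hom r (*) (\<lambda>x. \<epsilon> (g x))"
  by (rule module_hom_comp[OF _ counit_linear])

lemma lift2_coprod_hom [linear_intros]:
  assumes "bilinear_map s t \<beta>" "module_hom r s g"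
  shows "module_hom r t (\<lambda>x. lift2 \<beta> (\<Delta> (g x)))"
proof -
  interpret g: module_hom r s g by fact
  interpret \<beta>: module_hom s t "\<beta> 0" using bilinear_mapD(2)[OF assms(1)] .
  show ?thesis
    by unfold_locales
      (simp_all add: g.add g.scale coprod_add coprod_scale lift2_tadd2[OF assms(1)] lift2_tscale2[OF assms(1)])
qed

lemma lift2_coprod_mult:
  assumes "bilinear_map s t \<beta>"
  shows "lift2 \<beta> (\<Delta> (\<xi> * \<eta>)) = lift2 (\<lambda>x y. lift2 (\<lambda>x' y'. \<beta> (x * x') (y * y')) (\<Delta> \<eta>)) (\<Delta> \<xi>)"
  by (simp add: coprod_mult lift2_tmult2[OF assms])

lemma lift2_coprod_one: "bilinear_map s t \<beta> \<Longrightarrow> lift2 \<beta> (\<Delta> 1) = \<beta> 1 1"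
  by (simp add: coprod_one lift2_tone2)

lemma lift2_coassoc:
  assumes "trilinear_map s t \<gamma>"
  shows "lift2 (\<lambda>x y. lift2 (\<lambda>x\<^sub>1 x\<^sub>2. \<gamma> x\<^sub>1 x\<^sub>2 y) (\<Delta> x)) (\<Delta> \<xi>)
    = lift2 (\<lambda>x y. lift2 (\<lambda>y\<^sub>1 y\<^sub>2. \<gamma> x y\<^sub>1 y\<^sub>2) (\<Delta> y)) (\<Delta> \<xi>)"
  using arg_cong[OF coassociative, of "lift3 \<gamma>" \<xi>]
  by (simp add: lift3_map_left[OF assms] lift3_map_right[OF assms])

lemma
  assumes "module_hom s t h"
  shows lift2_counit_right: "lift2 (\<lambda>x y. t (\<epsilon> y) (h x)) (\<Delta> \<xi>) = h \<xi>"
    and lift2_antipode_left: "lift2 (\<lambda>x y. h (S x * y)) (\<Delta> \<xi>) = t (\<epsilon> \<xi>) (h 1)"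
    and lift2_antipode_right: "lift2 (\<lambda>x y. h (x * S y)) (\<Delta> \<xi>) = t (\<epsilon> \<xi>) (h 1)"
proof -
  interpret h: module_hom s t h by fact
  note * = lift2_hom[OF assms, symmetric]
  show "lift2 (\<lambda>x y. t (\<epsilon> y) (h x)) (\<Delta> \<xi>) = h \<xi>"
    by (simp only: h.scale[symmetric] * counit_right)
  show "lift2 (\<lambda>x y. h (S x * y)) (\<Delta> \<xi>) = t (\<epsilon> \<xi>) (h 1)"
    "lift2 (\<lambda>x y. h (x * S y)) (\<Delta> \<xi>) = t (\<epsilon> \<xi>) (h 1)"
    by (simp_all only: h.scale * antipode_left antipode_right)
qed

lemma map_mult:
  "map_left s \<Delta> (tmult2 s T U) = tmult3 s (map_left s \<Delta> T) (map_left s \<Delta> U)"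
  "map_right s \<Delta> (tmult2 s T U) = tmult3 s (map_right s \<Delta> T) (map_right s \<Delta> U)"
proof -
  note [simp] = alg.lift_ops linear_intros lift2_coprod_mult[where t = qscale]
    lift3_map_left[where s = s and t = qscale] lift3_map_right[where s = s and t = qscale]
  show "map_left s \<Delta> (tmult2 s T U) = tmult3 s (map_left s \<Delta> T) (map_left s \<Delta> U)"
    by (rule alg.tensor_eqIs; simp) (simp only: lift2_swap[where U = U and T = "\<Delta> x" for x])
  show "map_right s \<Delta> (tmult2 s T U) = tmult3 s (map_right s \<Delta> T) (map_right s \<Delta> U)"
    by (rule alg.tensor_eqIs; simp) (simp only: lift2_swap[where U = U and T = "\<Delta> x" for x])
qed

lemma map_one: "map_left s \<Delta> (tone2 s) = alg.tone3" "map_right s \<Delta> (tone2 s) = alg.tone3"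
  by (rule alg.tensor_eqIs; simp add: alg.lift_ops linear_intros lift2_coprod_one[where t = qscale]
      lift3_map_left[where s = s and t = qscale] lift3_map_right[where s = s and t = qscale])+

lemma counit_tmult2:
  "lift2 (\<lambda>x y. s (\<epsilon> x) y) (tmult2 s T U) = lift2 (\<lambda>x y. s (\<epsilon> x) y) T * lift2 (\<lambda>x y. s (\<epsilon> x) y) U"
  "lift2 (\<lambda>x y. s (\<epsilon> y) x) (tmult2 s T U) = lift2 (\<lambda>x y. s (\<epsilon> y) x) T * lift2 (\<lambda>x y. s (\<epsilon> y) x) U"
  by (subst lift2_tmult2[where t = s], (auto intro!: linear_intros)[1],
      subst lift2_hom[OF alg.mult_hom(2)[OF alg.self_hom]], subst lift2_hom[OF alg.mult_hom(1)[OF alg.self_hom]],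
      simp add: counit_mult alg.scale_left alg.scale_right mult.commute)+

lemma counit_tone2:
  "lift2 (\<lambda>x y. s (\<epsilon> x) y) (tone2 s) = 1" "lift2 (\<lambda>x y. s (\<epsilon> y) x) (tone2 s) = 1"
  by (subst lift2_tone2[where t = s], auto intro!: linear_intros simp: counit_one)+

lemma antipode_one: "S 1 = 1"
  using lift2_antipode_left[of s "\<lambda>x. x" 1]
  by (simp add: linear_intros lift2_coprod_one[where t = s] counit_one)

text \<open>Reinserting \<open>w = \<xi>\<^sub>2 S(\<xi>\<^sub>3) w\<close> removes the action of \<open>\<xi>\<^sub>2\<close>.\<close>

lemma coprod_cancel:
  assumes M: "hmodule_on UNIV H M"
    and lin: "\<And>w. module_hom s t (\<lambda>\<xi>. \<phi> \<xi> w)" "\<And>\<xi>. module_hom (scale M) t (\<lambda>w. \<phi> \<xi> w)"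
    and zero: "\<And>\<xi> w. lift2 (\<lambda>x y. \<phi> x (act M y w)) (\<Delta> \<xi>) = 0"
  shows "\<phi> \<xi> w = 0"
proof -
  interpret M: hmodule_on UNIV H M by fact
  note [linear_intros] = module_hom_comp[OF _ lin(1)] module_hom_comp[OF _ lin(2)]
  have "\<phi> \<xi> w = lift2 (\<lambda>x y. t (\<epsilon> y) (\<phi> x w)) (\<Delta> \<xi>)"
    by (rule lift2_counit_right[symmetric, OF lin(1)])
  also have "\<dots> = lift2 (\<lambda>x y. lift2 (\<lambda>y\<^sub>1 y\<^sub>2. \<phi> x (act M (y\<^sub>1 * S y\<^sub>2) w)) (\<Delta> y)) (\<Delta> \<xi>)"
    by (subst lift2_antipode_right[where t = t]) (auto intro!: linear_intros simp: M.act_one)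
  also have "\<dots> = lift2 (\<lambda>x y. lift2 (\<lambda>x\<^sub>1 x\<^sub>2. \<phi> x\<^sub>1 (act M (x\<^sub>2 * S y) w)) (\<Delta> x)) (\<Delta> \<xi>)"
    by (rule lift2_coassoc[symmetric, where t = t]) (auto intro!: linear_intros)
  also have "\<dots> = 0"
    by (simp add: M.act_mult zero lift2_0)
  finally show ?thesis .
qed

text \<open>As \<open>y * y'\<close> acts by \<open>y'\<close> followed by \<open>y\<close>, the
  legs of \<eta> are stripped first, from a map that still contains the sum over the coproduct of
  \<xi>; the legs of \<xi> follow.\<close>

lemma coprod_cancel_twice:
  assumes M: "hmodule_on UNIV H M"
    and lin: "\<And>\<eta> w. module_hom s t (\<lambda>\<xi>. \<phi> \<xi> \<eta> w)" "\<And>\<xi> w. module_hom s t (\<lambda>\<eta>. \<phi> \<xi> \<eta> w)"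
      "\<And>\<xi> \<eta>. module_hom (scale M) t (\<lambda>w. \<phi> \<xi> \<eta> w)"
    and zero: "\<And>\<xi> \<eta> w. lift2 (\<lambda>x y. lift2 (\<lambda>x' y'. \<phi> x x' (act M (y * y') w)) (\<Delta> \<eta>)) (\<Delta> \<xi>) = 0"
  shows "\<phi> \<xi> \<eta> w = 0"
proof -
  interpret M: hmodule_on UNIV H M by fact
  note [linear_intros] = module_hom_comp[OF _ lin(1)] module_hom_comp[OF _ lin(2)]
    module_hom_comp[OF _ lin(3)]
  have "lift2 (\<lambda>x y. \<phi> x \<eta> (act M y w)) (\<Delta> \<xi>) = 0" for \<xi> \<eta> w
  proof (rule coprod_cancel[OF M, where \<phi> = "\<lambda>\<eta> w. lift2 (\<lambda>x y. \<phi> x \<eta> (act M y w)) (\<Delta> \<xi>)"])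
    show "lift2 (\<lambda>x' y'. lift2 (\<lambda>x y. \<phi> x x' (act M y (act M y' w))) (\<Delta> \<xi>)) (\<Delta> \<eta>) = 0" for \<eta> w
      by (subst lift2_swap) (simp add: zero flip: M.act_mult)
  qed (auto intro!: linear_intros M.module_axioms)
  then show ?thesis
    by (intro coprod_cancel[OF M, where \<phi> = "\<lambda>\<xi> w. \<phi> \<xi> \<eta> w"]) (auto intro!: lin)
qed

lemma hmodule_regular: "hmodule_on UNIV H \<lparr>scale = s, act = (*)\<rparr>"
  by (unfold_locales)
    (simp_all add: alg.scale_right_distrib alg.scale_left_distrib distrib_left distrib_right mult.assoc
      alg.scale_left alg.scale_right)

text \<open>Both candidates are convolution inverse to the multiplication: put in front of
  \<open>\<xi>\<^sub>2 * \<eta>\<^sub>2 * w\<close>, with the first legs as arguments, each sums to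
  \<open>\<epsilon> \<xi> * \<epsilon> \<eta>\<close> times \<open>w\<close>. Cancelling the second
  legs makes them equal.\<close>

lemma antipode_mult: "S (\<xi> * \<eta>) = S \<eta> * S \<xi>"
proof -
  define \<phi> where "\<phi> \<xi> \<eta> w = S (\<xi> * \<eta>) * w - S \<eta> * S \<xi> * w" for \<xi> \<eta> w
  have "\<phi> \<xi> \<eta> 1 = 0"
  proof (rule coprod_cancel_twice[OF hmodule_regular, where t = s and \<phi> = \<phi>])
    fix \<xi> \<eta> w
    have "lift2 (\<lambda>x y. lift2 (\<lambda>x' y'. S (x * x') * (y * y') * w) (\<Delta> \<eta>)) (\<Delta> \<xi>)
        = lift2 (\<lambda>x y. S x * y * w) (\<Delta> (\<xi> * \<eta>))"
      by (rule lift2_coprod_mult[symmetric, where t = s]) (auto intro!: linear_intros)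
    also have "\<dots> = s (\<epsilon> \<xi> * \<epsilon> \<eta>) w"
      by (subst lift2_antipode_left[where h = "\<lambda>x. x * w" and t = s]) (auto intro!: linear_intros simp: counit_mult)
    also have "\<dots> = lift2 (\<lambda>x' y'. s (\<epsilon> \<xi>) (S x' * y' * w)) (\<Delta> \<eta>)"
      by (subst lift2_antipode_left[where h = "\<lambda>x. s (\<epsilon> \<xi>) (x * w)" and t = s])
        (auto intro!: linear_intros simp: mult.commute)
    \<comment> \<open>The other counit is expanded between \<open>S x'\<close> and
      \<open>y'\<close>, which produces the product of antipodes in reversed order.\<close>
    also have "\<dots> = lift2 (\<lambda>x' y'. lift2 (\<lambda>x y. S x' * (S x * y) * (y' * w)) (\<Delta> \<xi>)) (\<Delta> \<eta>)"
      by (subst lift2_antipode_left[where h = "\<lambda>x. S x' * x * (y' * w)" and t = s for x' y'])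
        (auto intro!: linear_intros simp: mult.assoc)
    finally show "lift2 (\<lambda>x y. lift2 (\<lambda>x' y'. \<phi> x x' (act \<lparr>scale = s, act = (*)\<rparr> (y * y') w)) (\<Delta> \<eta>)) (\<Delta> \<xi>) = 0"
      by (subst (asm) (2) lift2_swap) (simp add: \<phi>_def lift2_diff mult.assoc)
  qed (auto intro!: linear_intros simp: \<phi>_def)
  then show ?thesis
    by (simp add: \<phi>_def)
qed

end


section \<open>Endomorphisms of a bimodule\<close>

lemma End_alg_simps [simp]:
  "scale (End_alg H V) = (\<lambda>k P v. scale V k (P v))"
  "lmul (End_alg H V) a P = lmul V a \<circ> P"
  "rmul (End_alg H V) P a = P \<circ> lmul V a"
  "emult (End_alg H V) = (\<circ>)"
  "eunit (End_alg H V) = id"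
  by (simp_all add: End_alg_def)

lemma act_End_alg:
  "act (End_alg H V) \<xi> P v = lift2 (\<lambda>x y. act V x (P (act V (antipode H y) v))) (coprod H \<xi>)"
  by (simp add: End_alg_def lift2_apply)

lemma halg_of_simps [simp]:
  "scale (halg_of X) = scale X" "act (halg_of X) = act X"
  "amult (halg_of X) = emult X" "aunit (halg_of X) = eunit X"
  by (simp_all add: halg_of_def)

lemma hmodule_on_cong:
  assumes "hmodule_on E H M" "scale N = scale M" "act N = act M"
  shows "hmodule_on E H N"
  using assms by (simp add: hmodule_on_def hmodule_on_axioms_def)

lemma lift2_comp_apply: "lift2 (\<lambda>x y. \<alpha> x y \<circ> \<beta> x y) T v = lift2 (\<lambda>x y. \<alpha> x y (\<beta> x y v)) T"
  by (simp add: lift2_apply)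

locale hopf_bimodule = hopf_algebra H + V: module_bimodule_on UNIV H A V
  for H :: "('k::comm_ring_1, 'h::ring_1) hopf"
    and A :: "('k, 'h, 'a::ab_group_add) halg"
    and V :: "('k, 'h, 'a, 'v::ab_group_add) hbimod"
begin

abbreviation linear_on_V :: "('v \<Rightarrow> 'v) \<Rightarrow> bool"
  where "linear_on_V \<equiv> module_hom (scale V) (scale V)"

abbreviation adj :: "'h \<Rightarrow> ('v \<Rightarrow> 'v) \<Rightarrow> 'v \<Rightarrow> 'v"
  where "adj \<equiv> act (End_alg H V)"

lemma V_hom [linear_intros]: "linear_on_V (\<lambda>v. v)"
  by (rule module_hom_idI) (rule V.module_axioms)

lemma A_hom [linear_intros]: "module_hom (scale A) (scale A) (\<lambda>v. v)"
  by (rule module_hom_idI) (rule V.base.module_axioms)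

lemma lmul_hom [linear_intros]:
  assumes "module_hom r (scale A) g"
  shows "module_hom r (scale V) (\<lambda>x. lmul V (g x) v)"
proof -
  interpret g: module_hom r "scale A" g by fact
  show ?thesis
    by unfold_locales (simp_all add: g.add g.scale V.lmul_add_left V.lmul_scale_left)
qed

lemma lmul_hom_right [linear_intros]:
  assumes "module_hom r (scale V) g"
  shows "module_hom r (scale V) (\<lambda>x. lmul V a (g x))"
proof -
  interpret g: module_hom r "scale V" g by fact
  show ?thesis
    by unfold_locales (simp_all add: g.add g.scale V.lmul_add_right V.lmul_scale_right)
qed

lemma rmul_hom [linear_intros]:
  assumes "module_hom r (scale V) g"
  shows "module_hom r (scale V) (\<lambda>x. rmul V (g x) a)"
proof -
  interpret g: module_hom r "scale V" g by fact
  show ?thesis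
    by unfold_locales (simp_all add: g.add g.scale V.rmul_add_left V.rmul_scale_left)
qed

lemma rmul_hom_right [linear_intros]:
  assumes "module_hom r (scale A) g"
  shows "module_hom r (scale V) (\<lambda>x. rmul V v (g x))"
proof -
  interpret g: module_hom r "scale A" g by fact
  show ?thesis
    by unfold_locales (simp_all add: g.add g.scale V.rmul_add_right V.rmul_scale_right)
qed

lemma End_module: "module (scale (End_alg H V))"
  by unfold_locales
    (simp_all add: fun_eq_iff V.scale_right_distrib V.scale_left_distrib)

lemma End_subspace: "module.subspace (scale (End_alg H V)) (End_carrier V)"
proof -
  interpret module "scale (End_alg H V)"
    by (rule End_module)
  show ?thesis
  proof (rule subspaceI)
    show "0 \<in> End_carrier V"
      using V.rmul_scale_left[of 0 0] module_hom_diffI[OF V_hom V_hom] by (simp add: End_carrier_def zero_fun_def)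
    show "P + Q \<in> End_carrier V" if "P \<in> End_carrier V" "Q \<in> End_carrier V" for P Q
      using that by (auto simp: End_carrier_def plus_fun_def V.rmul_add_left intro!: linear_intros)
    show "scale (End_alg H V) k P \<in> End_carrier V" if "P \<in> End_carrier V" for k P
      using that by (auto simp: End_carrier_def V.rmul_scale_left intro!: linear_intros)
  qed
qed

section \<open>The adjoint action on linear endomorphisms\<close>

context
  fixes P assumes P: "linear_on_V P"
begin

lemmas P_hom [linear_intros] = module_hom_comp[OF _ P]

lemma adj_linear: "linear_on_V (adj \<xi> P)"
  unfolding act_End_alg by (auto intro!: linear_intros)

lemma adj_hom: "module_hom s (scale V) (\<lambda>\<xi>. adj \<xi> P v)"
  unfolding act_End_alg by (auto intro!: linear_intros)

lemma adj_hom_comp: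
  "module_hom r s g \<Longrightarrow> module_hom r (scale V) (\<lambda>x. adj (g x) P v)"
  by (rule module_hom_comp[OF _ adj_hom])

lemma adj_linear_comp:
  "module_hom r (scale V) g \<Longrightarrow> module_hom r (scale V) (\<lambda>x. adj \<xi> P (g x))"
  by (rule module_hom_comp[OF _ adj_linear])

text \<open>The right-hand side reads
  \<open>\<xi>\<^sub>1 P(S(\<xi>\<^sub>2) \<xi>\<^sub>3 v)\<close>. Coassociativity brings the last
  two legs together, and the antipode reduces them to a counit.\<close>

lemma adj_eval: "act V \<xi> (P v) = lift2 (\<lambda>x y. adj x P (act V y v)) (\<Delta> \<xi>)"
proof -
  have "lift2 (\<lambda>x y. adj x P (act V y v)) (\<Delta> \<xi>)
      = lift2 (\<lambda>x y. lift2 (\<lambda>y\<^sub>1 y\<^sub>2. act V x (P (act V (S y\<^sub>1) (act V y\<^sub>2 v)))) (\<Delta> y)) (\<Delta> \<xi>)"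
    unfolding act_End_alg by (rule lift2_coassoc[where t = "scale V"]) (auto intro!: linear_intros)
  also have "\<dots> = lift2 (\<lambda>x y. lift2 (\<lambda>y\<^sub>1 y\<^sub>2. act V x (P (act V (S y\<^sub>1 * y\<^sub>2) v))) (\<Delta> y)) (\<Delta> \<xi>)"
    by (simp add: V.act_mult)
  also have "\<dots> = lift2 (\<lambda>x y. scale V (\<epsilon> y) (act V x (P v))) (\<Delta> \<xi>)"
    by (subst lift2_antipode_left[where t = "scale V"]) (auto intro!: linear_intros simp: V.act_one)
  also have "\<dots> = act V \<xi> (P v)"
    by (rule lift2_counit_right) (auto intro!: linear_intros)
  finally show ?thesis ..
qed

lemma adj_mult: "adj (\<xi> * \<eta>) P = adj \<xi> (adj \<eta> P)"
proof
  fix v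
  have "adj (\<xi> * \<eta>) P v = lift2 (\<lambda>x y. lift2 (\<lambda>x' y'. act V (x * x') (P (act V (S (y * y')) v))) (\<Delta> \<eta>)) (\<Delta> \<xi>)"
    unfolding act_End_alg by (rule lift2_coprod_mult) (auto intro!: linear_intros)
  also have "\<dots> = adj \<xi> (adj \<eta> P) v"
    unfolding act_End_alg
    by (subst lift2_hom[where t = "scale V" and h = "act V x" for x]) (auto intro!: linear_intros simp: V.act_mult antipode_mult)
  finally show "adj (\<xi> * \<eta>) P v = adj \<xi> (adj \<eta> P) v" .
qed

lemma adj_one: "adj 1 P = P"
  by (rule ext, unfold act_End_alg, subst lift2_coprod_one[where t = "scale V"])
    (auto intro!: linear_intros simp: antipode_one V.act_one)

end

text \<open>Outside the context the map in this rule is schematic, so it would apply to any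
  linearity goal with target \<open>V\<close>. Later proofs add it for the particular maps at
  hand.\<close>

declare P_hom [linear_intros del]

lemma adj_add: "linear_on_V P \<Longrightarrow> linear_on_V Q \<Longrightarrow> adj \<xi> (P + Q) = adj \<xi> P + adj \<xi> Q"
  by (simp add: fun_eq_iff act_End_alg V.act_add_right lift2_add)

lemma adj_scale: "adj \<xi> (\<lambda>v. scale V k (P v)) = (\<lambda>v. scale V k (adj \<xi> P v))"
  by (simp add: fun_eq_iff act_End_alg V.act_scale_right
      lift2_hom[OF V.module_hom_scale_self])

text \<open>After expansion of the action on \<open>Q\<close>, coassociativity leaves a first leg
  acting on \<open>P\<close> and a second on its argument. By \<open>adj_eval\<close> they amount to
  one element acting after \<open>P\<close>, and the definition for \<open>P \<circ> Q\<close>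
  remains.\<close>

lemma adj_comp:
  assumes P: "linear_on_V P" and Q: "linear_on_V Q"
  shows "adj \<xi> (P \<circ> Q) = lift2 (\<lambda>x y. adj x P \<circ> adj y Q) (\<Delta> \<xi>)"
proof
  fix v
  note [linear_intros] = P_hom[OF P] P_hom[OF Q] adj_hom_comp[OF P] adj_linear_comp[OF P]
  have "lift2 (\<lambda>x y. adj x P \<circ> adj y Q) (\<Delta> \<xi>) v
      = lift2 (\<lambda>x y. lift2 (\<lambda>y\<^sub>1 y\<^sub>2. adj x P (act V y\<^sub>1 (Q (act V (S y\<^sub>2) v)))) (\<Delta> y)) (\<Delta> \<xi>)"
    unfolding lift2_comp_apply act_End_alg[of _ _ _ Q] by (subst lift2_hom[OF adj_linear[OF P]]) simp
  also have "\<dots> = lift2 (\<lambda>x y. lift2 (\<lambda>x\<^sub>1 x\<^sub>2. adj x\<^sub>1 P (act V x\<^sub>2 (Q (act V (S y) v)))) (\<Delta> x)) (\<Delta> \<xi>)"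
    by (rule lift2_coassoc[where t = "scale V", symmetric]) (auto intro!: linear_intros)
  also have "\<dots> = adj \<xi> (P \<circ> Q) v"
    by (simp only: adj_eval[OF P, symmetric]) (simp add: act_End_alg)
  finally show "adj \<xi> (P \<circ> Q) v = lift2 (\<lambda>x y. adj x P \<circ> adj y Q) (\<Delta> \<xi>) v" ..
qed

lemma adj_id: "adj \<xi> id = (\<lambda>v. scale V (\<epsilon> \<xi>) v)"
proof
  fix v
  have "adj \<xi> id v = lift2 (\<lambda>x y. act V (x * S y) v) (\<Delta> \<xi>)"
    by (simp add: act_End_alg V.act_mult)
  also have "\<dots> = scale V (\<epsilon> \<xi>) v"
    by (subst lift2_antipode_right[where t = "scale V"]) (auto intro!: linear_intros simp: V.act_one)
  finally show "adj \<xi> id v = scale V (\<epsilon> \<xi>) v" .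
qed

lemma lmul_linear: "linear_on_V (lmul V a)"
  using lmul_hom_right[OF V_hom] .

text \<open>After \<open>act_lmul\<close> the legs acting on \<open>v\<close> are
  \<open>\<xi>\<^sub>2 S(\<xi>\<^sub>3)\<close>, which collapse. Since both module structures on
  endomorphisms compose with left multiplications, this reduces their equivariance to
  \<open>adj_comp\<close>.\<close>

lemma adj_lmul: "adj \<xi> (lmul V a) = lmul V (act A \<xi> a)"
proof
  fix v
  have "adj \<xi> (lmul V a) v
      = lift2 (\<lambda>x y. lift2 (\<lambda>x\<^sub>1 x\<^sub>2. lmul V (act A x\<^sub>1 a) (act V (x\<^sub>2 * S y) v)) (\<Delta> x)) (\<Delta> \<xi>)"
    by (simp add: act_End_alg V.act_lmul V.act_mult)
  also have "\<dots> = lift2 (\<lambda>x y. lift2 (\<lambda>y\<^sub>1 y\<^sub>2. lmul V (act A x a) (act V (y\<^sub>1 * S y\<^sub>2) v)) (\<Delta> y)) (\<Delta> \<xi>)"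
    by (rule lift2_coassoc[where t = "scale V"]) (auto intro!: linear_intros)
  also have "\<dots> = lift2 (\<lambda>x y. scale V (\<epsilon> y) (lmul V (act A x a) v)) (\<Delta> \<xi>)"
    by (subst lift2_antipode_right[where t = "scale V"]) (auto intro!: linear_intros simp: V.act_one)
  also have "\<dots> = lmul V (act A \<xi> a) v"
    by (rule lift2_counit_right) (auto intro!: linear_intros)
  finally show "adj \<xi> (lmul V a) v = lmul V (act A \<xi> a) v" .
qed

text \<open>Let \<phi> be the defect of right linearity. Summed over \<open>\<xi>\<^sub>1\<close>,
  \<open>\<xi>\<^sub>2 v\<close> and \<open>\<xi>\<^sub>3 a\<close>, its two terms both become the
  action of \<xi> on \<open>P v\<close> times \<open>a\<close>, by equivariance of evaluation and of
  the right action. Hence this sum vanishes, and the extra legs can be cancelled.\<close>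

lemma adj_End_carrier:
  assumes "P \<in> End_carrier V"
  shows "adj \<xi> P \<in> End_carrier V"
proof -
  from assms have P: "linear_on_V P" and PA: "\<And>v a. P (rmul V v a) = rmul V (P v) a"
    by (auto simp: End_carrier_def)
  note [linear_intros] = P_hom[OF P] adj_hom_comp[OF P] adj_linear_comp[OF P]
  define \<phi> where "\<phi> \<xi> v a = adj \<xi> P (rmul V v a) - rmul V (adj \<xi> P v) a" for \<xi> v a
  have lin [linear_intros]:
    "module_hom r s g \<Longrightarrow> module_hom r (scale V) (\<lambda>\<xi>. \<phi> (g \<xi>) v a)"
    "module_hom r' (scale V) g' \<Longrightarrow> module_hom r' (scale V) (\<lambda>v. \<phi> \<xi> (g' v) a)"
    "module_hom r'' (scale A) g'' \<Longrightarrow> module_hom r'' (scale V) (\<lambda>a. \<phi> \<xi> v (g'' a))"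
    for \<xi> v a and r g and r' g' and r'' g''
    unfolding \<phi>_def by (auto intro!: linear_intros)
  have "lift2 (\<lambda>x y. lift2 (\<lambda>x\<^sub>1 x\<^sub>2. \<phi> x\<^sub>1 (act V x\<^sub>2 v) (act A y a)) (\<Delta> x)) (\<Delta> \<xi>) = 0" for \<xi> v a
  proof -
    have "lift2 (\<lambda>x y. lift2 (\<lambda>x\<^sub>1 x\<^sub>2. adj x\<^sub>1 P (rmul V (act V x\<^sub>2 v) (act A y a))) (\<Delta> x)) (\<Delta> \<xi>)
        = lift2 (\<lambda>x y. lift2 (\<lambda>y\<^sub>1 y\<^sub>2. adj x P (rmul V (act V y\<^sub>1 v) (act A y\<^sub>2 a))) (\<Delta> y)) (\<Delta> \<xi>)"
      by (rule lift2_coassoc[where t = "scale V"]) (auto intro!: linear_intros)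
    also have "\<dots> = lift2 (\<lambda>x y. adj x P (act V y (rmul V v a))) (\<Delta> \<xi>)"
      by (subst lift2_hom[OF adj_linear[OF P], symmetric]) (simp add: V.act_rmul)
    also have "\<dots> = act V \<xi> (rmul V (P v) a)"
      by (simp add: adj_eval[OF P, symmetric] PA)
    also have "\<dots> = lift2 (\<lambda>x y. rmul V (lift2 (\<lambda>x\<^sub>1 x\<^sub>2. adj x\<^sub>1 P (act V x\<^sub>2 v)) (\<Delta> x)) (act A y a)) (\<Delta> \<xi>)"
      by (simp add: V.act_rmul adj_eval[OF P])
    also have "\<dots> = lift2 (\<lambda>x y. lift2 (\<lambda>x\<^sub>1 x\<^sub>2. rmul V (adj x\<^sub>1 P (act V x\<^sub>2 v)) (act A y a)) (\<Delta> x)) (\<Delta> \<xi>)"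
      by (subst lift2_hom[OF rmul_hom[OF V_hom]]) simp
    finally show ?thesis
      by (simp add: \<phi>_def lift2_diff)
  qed
  \<comment> \<open>The leg on \<open>a\<close> is outermost and goes first, by cancellation over
    the module \<open>A\<close>; the leg on \<open>v\<close> goes next, over
    \<open>V\<close>.\<close>
  then have "lift2 (\<lambda>x\<^sub>1 x\<^sub>2. \<phi> x\<^sub>1 (act V x\<^sub>2 v) a) (\<Delta> \<xi>) = 0" for \<xi> v a
    by (intro coprod_cancel[OF V.base.hmodule_on_axioms, where t = "scale V"
        and \<phi> = "\<lambda>\<xi> a. lift2 (\<lambda>x\<^sub>1 x\<^sub>2. \<phi> x\<^sub>1 (act V x\<^sub>2 v) a) (\<Delta> \<xi>)"]) (auto intro!: linear_intros)
  then have "\<phi> \<xi> v a = 0" for \<xi> v a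
    by (intro coprod_cancel[OF V.hmodule_on_axioms, where t = "scale V" and \<phi> = "\<lambda>\<xi> v. \<phi> \<xi> v a"])
      (auto intro!: linear_intros)
  then show ?thesis
    by (simp add: End_carrier_def adj_linear[OF P] \<phi>_def)
qed

lemma End_linear: "P \<in> End_carrier V \<Longrightarrow> linear_on_V P"
  by (simp add: End_carrier_def)

lemma End_hmodule: "hmodule_on (End_carrier V) H (End_alg H V)"
proof -
  interpret module "scale (End_alg H V)"
    by (rule End_module)
  show ?thesis
  proof unfold_locales
    fix P Q \<xi> \<eta> k assume PQ: "P \<in> End_carrier V" "Q \<in> End_carrier V"
    note P = End_linear[OF PQ(1)] and Q = End_linear[OF PQ(2)]
    show "adj (\<xi> + \<eta>) P = adj \<xi> P + adj \<eta> P"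
      by (simp add: fun_eq_iff module_hom.add[OF adj_hom[OF P]])
    show "adj (hscale H k \<xi>) P = scale (End_alg H V) k (adj \<xi> P)"
      by (simp add: fun_eq_iff module_hom.scale[OF adj_hom[OF P]])
    show "adj \<xi> (P + Q) = adj \<xi> P + adj \<xi> Q"
      by (rule adj_add[OF P Q])
    show "adj \<xi> (scale (End_alg H V) k P) = scale (End_alg H V) k (adj \<xi> P)"
      by (simp add: adj_scale)
    show "adj (\<xi> * \<eta>) P = adj \<xi> (adj \<eta> P)" "adj 1 P = P"
      by (simp_all add: adj_mult[OF P] adj_one[OF P])
  qed (simp_all add: End_subspace[simplified] adj_End_carrier)
qed

lemma End_bimodule_algebra: "module_bimodule_algebra_on (End_carrier V) H A (End_alg H V)"
  unfolding module_bimodule_algebra_on_def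
proof
  interpret E: hmodule_on "End_carrier V" H "End_alg H V"
    by (rule End_hmodule)
  show "module_bimodule_on (End_carrier V) H A (End_alg H V)"
  proof unfold_locales
    fix P Q \<xi> a b k assume PQ: "P \<in> End_carrier V" "Q \<in> End_carrier V"
    note P = End_linear[OF PQ(1)] and Q = End_linear[OF PQ(2)]
    show "adj \<xi> (lmul (End_alg H V) a P) = lift2 (\<lambda>x y. lmul (End_alg H V) (act A x a) (adj y P)) (\<Delta> \<xi>)"
      by (simp add: adj_comp[OF lmul_linear P] adj_lmul)
    show "adj \<xi> (rmul (End_alg H V) P a) = lift2 (\<lambda>x y. rmul (End_alg H V) (adj x P) (act A y a)) (\<Delta> \<xi>)"
      by (simp add: adj_comp[OF P lmul_linear] adj_lmul)
    show "rmul (End_alg H V) P a \<in> End_carrier V"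
      using PQ lmul_linear by (auto simp: End_carrier_def V.lmul_rmul[symmetric] comp_def intro: module_hom_comp)
  qed (auto simp: fun_eq_iff End_carrier_def V.lmul_rmul V.lmul_add_left V.lmul_add_right V.lmul_scale_left
      V.lmul_scale_right V.lmul_mult V.lmul_unit module_hom.add module_hom.scale intro!: linear_intros
      intro: P_hom)
  have "hmodule_on (End_carrier V) H (halg_of (End_alg H V))"
    by (rule hmodule_on_cong[OF E.hmodule_on_axioms]) simp_all
  then interpret E': hmodule_on "End_carrier V" H "halg_of (End_alg H V)" .
  show "module_algebra_on (End_carrier V) H (halg_of (End_alg H V))"
  proof unfold_locales
    fix P Q \<xi> assume PQ: "P \<in> End_carrier V" "Q \<in> End_carrier V"
    note P = End_linear[OF PQ(1)] and Q = End_linear[OF PQ(2)]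
    show "act (halg_of (End_alg H V)) \<xi> (amult (halg_of (End_alg H V)) P Q) =
      lift2 (\<lambda>x y. amult (halg_of (End_alg H V)) (act (halg_of (End_alg H V)) x P)
        (act (halg_of (End_alg H V)) y Q)) (\<Delta> \<xi>)"
      by (simp add: adj_comp[OF P Q])
  qed (auto simp: fun_eq_iff End_carrier_def module_hom.add module_hom.scale adj_id comp_def
      intro: module_hom_comp V_hom[folded id_def] E'.carrier_subspace[simplified])
qed

end


section \<open>Equivariant pairings and their deformation\<close>

lemma (in hmodule_on) act_lift2:
  assumes "\<And>x y. \<beta> x y \<in> E"
  shows "act M \<xi> (lift2 \<beta> T) = lift2 (\<lambda>x y. act M \<xi> (\<beta> x y)) T"
  by (rule lift2_hom_on[OF module_axioms carrier_subspace]) (simp_all add: act_add_right assms)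

text \<open>An \<open>H\<close>-equivariant map X \<otimes> Y \<rightarrow> Z in curried form. The
  product of \<open>A\<close>, both actions on \<open>V\<close>, evaluation and composition are all
  of this kind. Carriers are needed since the right linear endomorphisms form only a subset of their
  type.\<close>

locale pairing = X: hmodule_on CX H X + Y: hmodule_on CY H Y + Z: hmodule_on CZ H Z
  for H :: "('k::comm_ring_1, 'h::ring_1) hopf"
    and CX and X :: "('k, 'h, 'x::ab_group_add, 'mx) hmod_scheme"
    and CY and Y :: "('k, 'h, 'y::ab_group_add, 'my) hmod_scheme"
    and CZ and Z :: "('k, 'h, 'z::ab_group_add, 'mz) hmod_scheme" +
  fixes p :: "'x \<Rightarrow> 'y \<Rightarrow> 'z"
  assumes closed: "x \<in> CX \<Longrightarrow> y \<in> CY \<Longrightarrow> p x y \<in> CZ"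
    and add_left: "x \<in> CX \<Longrightarrow> x' \<in> CX \<Longrightarrow> y \<in> CY \<Longrightarrow> p (x + x') y = p x y + p x' y"
    and add_right: "x \<in> CX \<Longrightarrow> y \<in> CY \<Longrightarrow> y' \<in> CY \<Longrightarrow> p x (y + y') = p x y + p x y'"
    and scale_left: "x \<in> CX \<Longrightarrow> y \<in> CY \<Longrightarrow> p (scale X k x) y = scale Z k (p x y)"
    and scale_right: "x \<in> CX \<Longrightarrow> y \<in> CY \<Longrightarrow> p x (scale Y k y) = scale Z k (p x y)"
    and equivariant: "x \<in> CX \<Longrightarrow> y \<in> CY \<Longrightarrow>
      act Z \<xi> (p x y) = lift2 (\<lambda>a b. p (act X a x) (act Y b y)) (coprod H \<xi>)"
begin

lemma hom_left [linear_intros]: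
  assumes "module_hom r (scale X) g" "\<And>a. g a \<in> CX" "y \<in> CY"
  shows "module_hom r (scale Z) (\<lambda>a. p (g a) y)"
proof -
  interpret g: module_hom r "scale X" g by fact
  show ?thesis
    by unfold_locales (simp_all add: g.add g.scale add_left scale_left assms)
qed

lemma hom_right [linear_intros]:
  assumes "module_hom r (scale Y) g" "\<And>a. g a \<in> CY" "x \<in> CX"
  shows "module_hom r (scale Z) (\<lambda>a. p x (g a))"
proof -
  interpret g: module_hom r "scale Y" g by fact
  show ?thesis
    by unfold_locales (simp_all add: g.add g.scale add_right scale_right assms)
qed

lemma lift2_left:
  assumes "\<And>a b. \<beta> a b \<in> CX" "y \<in> CY"
  shows "p (lift2 \<beta> T) y = lift2 (\<lambda>a b. p (\<beta> a b) y) T"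
  by (rule lift2_hom_on[OF X.module_axioms X.carrier_subspace, where h = "\<lambda>x. p x y"])
    (simp_all add: add_left assms)

lemma lift2_right:
  assumes "\<And>a b. \<beta> a b \<in> CY" "x \<in> CX"
  shows "p x (lift2 \<beta> T) = lift2 (\<lambda>a b. p x (\<beta> a b)) T"
  by (rule lift2_hom_on[OF Y.module_axioms Y.carrier_subspace]) (simp_all add: add_right assms)

end

lemma (in module_algebra_on) pairing_amult: "pairing H E A E A E A (amult A)"
  by unfold_locales (simp_all add: closed add_left add_right scale_left scale_right act_amult)

lemma (in module_bimodule_on) pairing_lmul: "pairing H UNIV A E V E V (lmul V)"
  by unfold_locales (simp_all add: lmul_closed lmul_add_left lmul_add_right lmul_scale_left
      lmul_scale_right act_lmul)

lemma (in module_bimodule_on) pairing_rmul: "pairing H E V UNIV A E V (rmul V)"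
  by unfold_locales (simp_all add: rmul_closed rmul_add_left rmul_add_right rmul_scale_left
      rmul_scale_right act_rmul)

text \<open>
  The situation of a Hopf algebra \<open>H\<close> and its twist \<open>H'\<close> by \<open>F = G\<^sup>-\<^sup>1\<close>, described by properties
  that also hold for \<open>H'\<close> and its twist \<open>H\<close> by \<open>G\<close>.
\<close>

locale twist_pair = hopf_algebra H + tw: hopf_algebra H'
  for H H' :: "('k::comm_ring_1, 'h::ring_1) hopf" +
  fixes F G :: "'h tensor2"
  assumes hscale_twist: "hscale H' = s" and counit_twist: "counit H' = \<epsilon>"
    and F_closed: "F \<in> tensors2 s" and G_closed: "G \<in> tensors2 s"
    and FG: "tmult2 s F G = tone2 s" and GF: "tmult2 s G F = tone2 s"
    and coprod_twist: "coprod H' \<xi> = tmult2 s (tmult2 s F (\<Delta> \<xi>)) G"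
    and cocycle: "tmult3 s (map_left s \<Delta> G) (tensor_one s G)
      = tmult3 s (map_right s \<Delta> G) (one_tensor s G)"
    and counit_left_G: "lift2 (\<lambda>x y. s (\<epsilon> x) y) G = 1"
    and counit_right_G: "lift2 (\<lambda>x y. s (\<epsilon> y) x) G = 1"
begin

lemma inverse2_F: "inverse2 s F = G"
  by (rule alg.inverse2_eq) (simp_all add: is_inverse2_def F_closed G_closed FG GF)

lemma star_eq: "star H F act1 act2 p x y = lift2 (\<lambda>f g. p (act1 f x) (act2 g y)) G"
  by (simp add: star_def inverse2_F)

lemma G_coprod_twist: "tmult2 s G (coprod H' \<xi>) = tmult2 s (\<Delta> \<xi>) G"
  by (simp add: coprod_twist GF coprod_closed alg.tmult2_one flip: alg.tmult2_assoc)

lemma hmodule_twist: "hmodule_on E H M \<Longrightarrow> hmodule_on E H' M"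
  by (simp add: hmodule_on_def hmodule_on_axioms_def hscale_twist)

text \<open>Acting with \<xi> after the deformed pairing evaluates the old one at \<Delta>(\<xi>)
  \<open>G\<close>. This equals \<open>G\<close> times the twisted coproduct of \<xi>, which is the
  deformed pairing after the twisted action.\<close>

lemma pairing_star:
  assumes "pairing H CX X CY Y CZ Z p"
  shows "pairing H' CX X CY Y CZ Z (star H F (act X) (act Y) p)"
proof -
  interpret pairing H CX X CY Y CZ Z p by fact
  have lin: "bilinear_map s (scale Z) (\<lambda>a b. p (act X a x) (act Y b y))" if "x \<in> CX" "y \<in> CY" for x y
    using that by (auto intro!: linear_intros simp: X.act_closed Y.act_closed)
  interpret X': hmodule_on CX H' X by (rule hmodule_twist) (rule X.hmodule_on_axioms)
  interpret Y': hmodule_on CY H' Y by (rule hmodule_twist) (rule Y.hmodule_on_axioms)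
  interpret Z': hmodule_on CZ H' Z by (rule hmodule_twist) (rule Z.hmodule_on_axioms)
  show ?thesis
  proof unfold_locales
    fix x y \<xi> assume [simp]: "x \<in> CX" "y \<in> CY"
    note lin = lin[of x y, OF \<open>x \<in> CX\<close> \<open>y \<in> CY\<close>]
    have "act Z \<xi> (star H F (act X) (act Y) p x y) = lift2 (\<lambda>a b. p (act X a x) (act Y b y)) (tmult2 s (\<Delta> \<xi>) G)"
      unfolding star_eq lift2_tmult2[OF lin]
      by (subst lift2_swap)
        (simp add: Z.act_lift2 closed X.act_closed Y.act_closed equivariant X.act_mult Y.act_mult)
    also have "\<dots> = lift2 (\<lambda>a b. p (act X a x) (act Y b y)) (tmult2 s G (coprod H' \<xi>))"
      by (simp add: G_coprod_twist)
    also have "\<dots> = lift2 (\<lambda>a b. star H F (act X) (act Y) p (act X a x) (act Y b y)) (coprod H' \<xi>)"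
      unfolding star_eq lift2_tmult2[OF lin]
      by (subst lift2_swap) (simp add: X.act_mult Y.act_mult)
    finally show "act Z \<xi> (star H F (act X) (act Y) p x y)
        = lift2 (\<lambda>a b. star H F (act X) (act Y) p (act X a x) (act Y b y)) (coprod H' \<xi>)" .
  qed (auto simp: star_eq lift2_mem[OF Z.module_axioms Z.carrier_subspace] closed X.act_closed Y.act_closed
      X.act_add_right Y.act_add_right X.act_scale_right Y.act_scale_right add_left add_right
      scale_left scale_right lift2_add lift2_hom[OF Z.module_hom_scale_self])
qed

text \<open>By equivariance of \<open>p\<close> and \<open>r\<close>, both sides are values of one
  trilinear map \<gamma>, at the two sides of \<open>cocycle\<close>. Allowing different modules in
  all slots lets one proof cover the products, the mixed bimodule laws, evaluation and
  composition.\<close>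

lemma star_assoc:
  assumes p: "pairing H CX X CY Y CU U p" and q: "pairing H CU U CZ Z CO T q"
    and r: "pairing H CY Y CZ Z CW W r" and t: "pairing H CX X CW W CO T t"
    and eq: "\<And>x y z. x \<in> CX \<Longrightarrow> y \<in> CY \<Longrightarrow> z \<in> CZ \<Longrightarrow> q (p x y) z = t x (r y z)"
    and [simp]: "x \<in> CX" "y \<in> CY" "z \<in> CZ"
  shows "star H F (act U) (act Z) q (star H F (act X) (act Y) p x y) z
    = star H F (act X) (act W) t x (star H F (act Y) (act Z) r y z)"
proof -
  interpret p: pairing H CX X CY Y CU U p by fact
  interpret q: pairing H CU U CZ Z CO T q by fact
  interpret r: pairing H CY Y CZ Z CW W r by fact
  interpret t: pairing H CX X CW W CO T t by fact
  note [simp] = p.closed q.closed r.closed t.closed p.X.act_closed p.Y.act_closed p.Z.act_closed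
    q.Y.act_closed r.Z.act_closed
  define \<gamma> where "\<gamma> a b c = q (p (act X a x) (act Y b y)) (act Z c z)" for a b c
  have \<gamma>: "trilinear_map s (scale T) \<gamma>"
    unfolding \<gamma>_def by (auto intro!: linear_intros)
  have "star H F (act U) (act Z) q (star H F (act X) (act Y) p x y) z
      = lift2 (\<lambda>f g. lift2 (\<lambda>f' g'. lift2 (\<lambda>a b. \<gamma> (a * f') (b * g') g) (\<Delta> f)) G) G"
    by (simp add: star_eq p.Z.act_lift2 p.equivariant q.lift2_left \<gamma>_def
        lift2_mem[OF p.Z.module_axioms p.Z.carrier_subspace] p.X.act_mult p.Y.act_mult)
  also have "\<dots> = lift3 \<gamma> (tmult3 s (map_left s \<Delta> G) (tensor_one s G))"
    by (simp add: lift3_tmult3[OF \<gamma>] lift3_map_left[where s = s and t = "scale T"]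
        lift3_tensor_one[where s = s and t = "scale T"] linear_intros trilinear_map_compose[OF \<gamma>])
      (simp only: lift2_swap[where U = G and T = "\<Delta> x" for x])
  also have "\<dots> = lift3 \<gamma> (tmult3 s (map_right s \<Delta> G) (one_tensor s G))"
    by (simp add: cocycle)
  also have "\<dots> = lift2 (\<lambda>f g. lift2 (\<lambda>f' g'. lift2 (\<lambda>a b. \<gamma> f (a * f') (b * g')) (\<Delta> g)) G) G"
    by (simp add: lift3_tmult3[OF \<gamma>] lift3_map_right[where s = s and t = "scale T"]
        lift3_one_tensor[where s = s and t = "scale T"] linear_intros trilinear_map_compose[OF \<gamma>])
      (simp only: lift2_swap[where U = G and T = "\<Delta> x" for x])
  also have "\<dots> = star H F (act X) (act W) t x (star H F (act Y) (act Z) r y z)"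
    by (simp add: star_eq r.Z.act_lift2 r.equivariant t.lift2_right \<gamma>_def eq
        lift2_mem[OF r.Z.module_axioms r.Z.carrier_subspace] p.Y.act_mult q.Y.act_mult)
  finally show ?thesis .
qed

text \<open>On \<open>u\<close> the first leg of \<open>G\<close> acts as a scalar; moved to the
  second leg, it leaves the action of
  \<open>lift2 (\<lambda>x y. s (\<epsilon> x) y) G = 1\<close>.\<close>

lemma star_unit_left:
  assumes "pairing H CX X CY Y CZ Z p" "u \<in> CX" "y \<in> CY"
    and "\<And>\<xi>. act X \<xi> u = scale X (\<epsilon> \<xi>) u"
  shows "star H F (act X) (act Y) p u y = p u y"
proof -
  interpret pairing H CX X CY Y CZ Z p by fact
  have "star H F (act X) (act Y) p u y = lift2 (\<lambda>f g. p u (act Y (s (\<epsilon> f) g) y)) G"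
    using assms by (simp add: star_eq scale_left scale_right Y.act_closed Y.act_scale_left)
  also have "\<dots> = p u (act Y (lift2 (\<lambda>f g. s (\<epsilon> f) g) G) y)"
    by (rule lift2_hom[symmetric]) (use assms in \<open>auto intro!: linear_intros simp: Y.act_closed\<close>)
  finally show ?thesis
    using assms by (simp add: counit_left_G Y.act_one)
qed

lemma star_unit_right:
  assumes "pairing H CX X CY Y CZ Z p" "x \<in> CX" "u \<in> CY"
    and "\<And>\<xi>. act Y \<xi> u = scale Y (\<epsilon> \<xi>) u"
  shows "star H F (act X) (act Y) p x u = p x u"
proof -
  interpret pairing H CX X CY Y CZ Z p by fact
  have "star H F (act X) (act Y) p x u = lift2 (\<lambda>f g. p (act X (s (\<epsilon> g) f) x) u) G"
    using assms by (simp add: star_eq scale_left scale_right X.act_closed X.act_scale_left)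
  also have "\<dots> = p (act X (lift2 (\<lambda>f g. s (\<epsilon> g) f) G) x) u"
    by (rule lift2_hom[symmetric]) (use assms in \<open>auto intro!: linear_intros simp: X.act_closed\<close>)
  finally show ?thesis
    using assms by (simp add: counit_right_G X.act_one)
qed

lemma deform_simps [simp]:
  "scale (deform_alg H F B) = scale B" "act (deform_alg H F B) = act B"
  "aunit (deform_alg H F B) = aunit B" "amult (deform_alg H F B) = star H F (act B) (act B) (amult B)"
  "scale (deform_bimod H F A V) = scale V" "act (deform_bimod H F A V) = act V"
  "lmul (deform_bimod H F A V) = star H F (act A) (act V) (lmul V)"
  "rmul (deform_bimod H F A V) = star H F (act V) (act A) (rmul V)"
  by (simp_all add: deform_alg_def deform_bimod_def)

lemma module_algebra_deform:
  assumes "module_algebra_on E H B"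
  shows "module_algebra_on E H' (deform_alg H F B)"
proof -
  interpret B: module_algebra_on E H B by fact
  interpret p: pairing H' E B E B E B "star H F (act B) (act B) (amult B)"
    by (rule pairing_star) (rule B.pairing_amult)
  interpret D: hmodule_on E H' "deform_alg H F B"
    by (rule hmodule_on_cong[OF p.X.hmodule_on_axioms]) simp_all
  note pair = B.pairing_amult
  show ?thesis
    by unfold_locales
      (auto simp: p.closed p.add_left p.add_right p.scale_left p.scale_right p.equivariant B.act_aunit
        B.unit_closed B.carrier_subspace counit_twist
        star_unit_left[OF pair] star_unit_right[OF pair] B.unit_left B.unit_right
        intro!: star_assoc[OF pair pair pair pair] B.assoc)
qed

lemma module_bimodule_deform:
  assumes "module_bimodule_on E H A V"
  shows "module_bimodule_on E H' (deform_alg H F A) (deform_bimod H F A V)"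
proof -
  interpret V: module_bimodule_on E H A V by fact
  note pa = V.base.pairing_amult and pl = V.pairing_lmul and pr = V.pairing_rmul
  interpret l: pairing H' UNIV A E V E V "star H F (act A) (act V) (lmul V)"
    by (rule pairing_star) (rule pl)
  interpret r: pairing H' E V UNIV A E V "star H F (act V) (act A) (rmul V)"
    by (rule pairing_star) (rule pr)
  interpret A: module_algebra_on UNIV H' "deform_alg H F A"
    by (rule module_algebra_deform) (rule V.base.module_algebra_on_axioms)
  interpret D: hmodule_on E H' "deform_bimod H F A V"
    by (rule hmodule_on_cong[OF l.Y.hmodule_on_axioms]) simp_all
  show ?thesis
    by unfold_locales
      (auto simp: l.closed l.add_left l.add_right l.scale_left l.scale_right l.equivariant
        r.closed r.add_left r.add_right r.scale_left r.scale_right r.equivariant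
        star_unit_left[OF pl] star_unit_right[OF pr] V.base.act_aunit V.lmul_unit V.rmul_unit
        \<comment> \<open>The three instances are associativity of the left action, of the right
          action (read backwards), and the commutation of the two.\<close>
        intro!: star_assoc[OF pa pl pl pl] star_assoc[OF pr pr pa pr, symmetric] star_assoc[OF pl pr pr pl]
        V.lmul_mult V.rmul_mult[symmetric] V.lmul_rmul)
qed

end


lemma module_bimodule_on_cong:
  assumes "module_bimodule_on E H A V"
    and "scale W = scale V" "act W = act V" "lmul W = lmul V" "rmul W = rmul V"
  shows "module_bimodule_on E H A W"
  using assms
  by (simp add: module_bimodule_on_def module_bimodule_on_axioms_def hmodule_on_def hmodule_on_axioms_def)

lemma (in hopf_bimodule) pairing_eval:
  "pairing H (End_carrier V) (End_alg H V) UNIV V UNIV V (\<lambda>P v. P v)"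
proof -
  interpret E: hmodule_on "End_carrier V" H "End_alg H V"
    by (rule End_hmodule)
  show ?thesis
    by unfold_locales
      (simp_all add: End_linear[THEN module_hom.add] End_linear[THEN module_hom.scale] adj_eval[OF End_linear])
qed

lemma (in hopf_bimodule) pairing_comp:
  "pairing H (End_carrier V) (End_alg H V) (End_carrier V) (End_alg H V) (End_carrier V) (End_alg H V) (\<circ>)"
proof -
  interpret E: hmodule_on "End_carrier V" H "End_alg H V"
    by (rule End_hmodule)
  have "adj \<xi> (P \<circ> Q) = lift2 (\<lambda>x y. adj x P \<circ> adj y Q) (\<Delta> \<xi>)"
    if "P \<in> End_carrier V" "Q \<in> End_carrier V" for \<xi> P Q
    using that by (rule adj_comp[OF End_linear End_linear])
  then show ?thesis
    by unfold_locales
      (auto simp: fun_eq_iff End_linear[THEN module_hom.add]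
        End_linear[THEN module_hom.scale] End_carrier_def comp_def intro: module_hom_comp)
qed

section \<open>Exchanging a Hopf algebra and its twist\<close>

context twist_pair
begin

lemma coprod_untwist: "\<Delta> \<xi> = tmult2 s (tmult2 s G (coprod H' \<xi>)) F"
  using F_closed by (simp add: G_coprod_twist alg.tmult2_assoc GF alg.tmult2_one coprod_closed)

lemma counit_inverse:
  "lift2 (\<lambda>x y. s (\<epsilon> x) y) F = 1" "lift2 (\<lambda>x y. s (\<epsilon> y) x) F = 1"
  using counit_tmult2[of F G] by (simp_all add: FG counit_left_G counit_right_G counit_tone2)

text \<open>Conjugation by \<open>F\<close> turns the two sides into
  \<open>tmult3 s (tensor_one s F) (map_left s \<Delta> F)\<close> and its mirror image. One is a
  left inverse and the other a right inverse of \<open>Z\<close>, the common value of the two sides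
  of \<open>cocycle\<close>, so they agree.\<close>

lemma cocycle_inverse:
  "tmult3 s (map_left s (coprod H') F) (tensor_one s F) = tmult3 s (map_right s (coprod H') F) (one_tensor s F)"
proof -
  note lift_coprod = lift2_coprod_hom[OF _ alg.self_hom]
  define Z where "Z = tmult3 s (map_left s \<Delta> G) (tensor_one s G)"
  have GF1: "tmult3 s (tensor_one s G) (tensor_one s F) = alg.tone3" "tmult3 s (one_tensor s G) (one_tensor s F) = alg.tone3"
    "tmult3 s (tensor_one s F) (tensor_one s G) = alg.tone3" "tmult3 s (one_tensor s F) (one_tensor s G) = alg.tone3"
    by (simp_all add: GF FG alg.tensor_one_one alg.one_tensor_one flip: alg.tensor_one_mult alg.one_tensor_mult)
  have left: "tmult3 s (map_left s (coprod H') F) (tensor_one s F) = tmult3 s (tensor_one s F) (map_left s \<Delta> F)"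
    by (simp add: alg.map_left_conj[OF coprod_twist lift_coprod] alg.tmult3_assoc GF1 alg.tmult3_one)
  have right: "tmult3 s (map_right s (coprod H') F) (one_tensor s F) = tmult3 s (one_tensor s F) (map_right s \<Delta> F)"
    by (simp add: alg.map_right_conj[OF coprod_twist lift_coprod] alg.tmult3_assoc GF1 alg.tmult3_one)
  have "tmult3 s (tmult3 s (tensor_one s F) (map_left s \<Delta> F)) Z
      = tmult3 s (tensor_one s F) (tmult3 s (map_left s \<Delta> (tmult2 s F G)) (tensor_one s G))"
    by (simp add: Z_def alg.tmult3_assoc map_mult)
  also have "\<dots> = alg.tone3"
    by (simp add: FG map_one alg.tmult3_one GF1)
  finally have "tmult3 s (tmult3 s (tensor_one s F) (map_left s \<Delta> F)) Z = alg.tone3" .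
  moreover have "tmult3 s Z (tmult3 s (one_tensor s F) (map_right s \<Delta> F))
      = tmult3 s (map_right s \<Delta> G) (tmult3 s (tmult3 s (one_tensor s G) (one_tensor s F)) (map_right s \<Delta> F))"
    by (simp add: Z_def cocycle alg.tmult3_assoc)
  then have "tmult3 s Z (tmult3 s (one_tensor s F) (map_right s \<Delta> F)) = alg.tone3"
    by (simp add: GF1 alg.tmult3_one GF map_one flip: map_mult)
  ultimately show ?thesis
    unfolding left right by (rule alg.tmult3_inverse_unique) simp_all
qed

lemma swap: "twist_pair H' H G F"
  using twist_pair_axioms
  by unfold_locales
    (simp_all add: hscale_twist counit_twist F_closed G_closed FG GF coprod_untwist[symmetric] cocycle_inverse
      counit_inverse)

text \<open>The first deformation inserts \<open>G\<close>; the second, being by \<open>G\<close>,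
  inserts its inverse \<open>F\<close>. Together they insert \<open>G * F\<close>, which is the unit
  tensor.\<close>

lemma star_star:
  assumes "pairing H UNIV X UNIV Y UNIV Z p"
  shows "star H' G (act X) (act Y) (star H F (act X) (act Y) p) = p"
proof (intro ext)
  interpret swap: twist_pair H' H G F by (rule swap)
  interpret pairing H UNIV X UNIV Y UNIV Z p by fact
  fix x y
  have lin: "bilinear_map s (scale Z) (\<lambda>a b. p (act X a x) (act Y b y))"
    by (auto intro!: linear_intros)
  have "star H' G (act X) (act Y) (star H F (act X) (act Y) p) x y
      = lift2 (\<lambda>a b. p (act X a x) (act Y b y)) (tmult2 s G F)"
    unfolding lift2_tmult2[OF lin] swap.star_eq star_eq
    by (subst lift2_swap) (simp add: X.act_mult Y.act_mult)
  also have "\<dots> = p x y"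
    by (simp add: GF lift2_tone2[OF lin] X.act_one Y.act_one)
  finally show "star H' G (act X) (act Y) (star H F (act X) (act Y) p) x y = p x y" .
qed

end

section \<open>The deformation isomorphism\<close>

locale twist_bimodule = twist_pair H H' F G + hopf_bimodule H A V
  for H H' :: "('k::comm_ring_1, 'h::ring_1) hopf" and F G
    and A :: "('k, 'h, 'a::ab_group_add) halg"
    and V :: "('k, 'h, 'a, 'v::ab_group_add) hbimod"
begin

abbreviation "A' \<equiv> deform_alg H F A"
abbreviation "V' \<equiv> deform_bimod H F A V"
abbreviation "D \<equiv> D_map H F V"

sublocale W: hopf_bimodule H' A' V'
  unfolding hopf_bimodule_def
  using module_bimodule_deform[OF V.module_bimodule_on_axioms] tw.hopf_algebra_axioms by simp

lemma D_eq_star: "D P v = star H F adj (act V) (\<lambda>P v. P v) P v"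
  by (simp add: D_map_def star_def lift2_comp_apply)

lemma D_apply: "D P v = lift2 (\<lambda>f g. adj f P (act V g v)) G"
  by (simp add: D_eq_star star_eq)

lemma pairing_D: "pairing H' (End_carrier V) (End_alg H V) UNIV V UNIV V D"
  using pairing_star[OF pairing_eval] by (simp add: D_eq_star[abs_def])

text \<open>Right linearity of \<open>P\<close> is an associativity law between evaluation and the
  right action, so \<open>star_assoc\<close> yields its deformed version.\<close>

lemma D_in_End:
  assumes "P \<in> End_carrier V"
  shows "D P \<in> End_carrier V'"
proof -
  interpret d: pairing H' "End_carrier V" "End_alg H V" UNIV V UNIV V D
    by (rule pairing_D)
  have "module_hom (scale V) (scale V) (D P)"
    using d.hom_right[OF V_hom _ assms] by simp
  moreover have "D P (rmul V' v a) = rmul V' (D P v) a" for v a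
    unfolding D_eq_star deform_simps
    by (rule star_assoc[symmetric, OF pairing_eval V.pairing_rmul V.pairing_rmul pairing_eval])
      (use assms in \<open>auto simp: End_carrier_def\<close>)
  ultimately show ?thesis
    by (simp add: End_carrier_def)
qed

lemma D_comp:
  assumes "P \<in> End_carrier V" "Q \<in> End_carrier V"
  shows "D (star H F adj adj (\<circ>) P Q) = D P \<circ> D Q"
proof
  show "D (star H F adj adj (\<circ>) P Q) v = (D P \<circ> D Q) v" for v
    using star_assoc[OF pairing_comp pairing_eval pairing_eval pairing_eval _ assms, of v]
    by (simp add: D_eq_star)
qed

lemma id_in_End: "id \<in> End_carrier V"
  using V_hom by (simp add: End_carrier_def id_def)

text \<open>\<open>H\<close> acts on the identity through the counit, so the unit rule for deformed
  pairings applies to evaluation.\<close>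

lemma D_id: "D id = id"
  by (rule ext, unfold D_eq_star, subst star_unit_left[OF pairing_eval])
    (simp_all add: id_in_End adj_id)

lemma lmul_in_End: "lmul V a \<in> End_carrier V"
  using lmul_linear by (simp add: End_carrier_def V.lmul_rmul)

lemma D_lmul: "D (lmul V a) = lmul V' a"
  by (rule ext) (simp add: D_apply star_eq adj_lmul)

text \<open>By \<open>adj_lmul\<close>, the deformed action of \<open>a\<close> on \<open>P\<close>
  is the deformed composite of \<open>lmul V a\<close> with \<open>P\<close>. Multiplicativity of
  \<open>D\<close> and its value on left multiplications then suffice.\<close>

lemma D_lmul_comp:
  assumes "P \<in> End_carrier V"
  shows "D (star H F (act A) adj (lmul (End_alg H V)) a P) = lmul V' a \<circ> D P"
  using D_comp[OF lmul_in_End assms] by (simp add: star_eq adj_lmul D_lmul)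

lemma D_rmul_comp:
  assumes "P \<in> End_carrier V"
  shows "D (star H F adj (act A) (rmul (End_alg H V)) P a) = D P \<circ> lmul V' a"
  using D_comp[OF assms lmul_in_End] by (simp add: star_eq adj_lmul D_lmul)

text \<open>Both families \<open>f \<xi>\<close> of endomorphisms satisfy
  \<open>\<xi> (D P v) = f(\<xi>\<^sub>1)(\<xi>\<^sub>2 v)\<close> for the twisted coproduct: one
  since \<open>D\<close> is a deformed pairing, the other by \<open>adj_eval\<close> in the twisted
  setting. The antipode of \<open>H'\<close> cancels the second leg of their difference.\<close>

lemma D_adj:
  assumes P: "P \<in> End_carrier V"
  shows "D (adj \<xi> P) = W.adj \<xi> (D P)"
proof
  fix v
  interpret d: pairing H' "End_carrier V" "End_alg H V" UNIV V UNIV V D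
    by (rule pairing_D)
  note DP = W.End_linear[OF D_in_End[OF P]]
  define \<phi> where "\<phi> \<xi> v = D (adj \<xi> P) v - W.adj \<xi> (D P) v" for \<xi> v
  have "\<phi> \<xi> v = 0"
  proof (rule tw.coprod_cancel[OF W.V.hmodule_on_axioms, where t = "scale V" and \<phi> = \<phi>])
    show "module_hom tw.s (scale V) (\<lambda>\<xi>. \<phi> \<xi> v)" for v
      using d.X.act_hom[OF tw.alg.self_hom P] W.adj_hom[OF DP]
      unfolding \<phi>_def
      by (auto intro!: module_hom_diffI d.hom_left simp: adj_End_carrier P)
    show "module_hom (scale V') (scale V) (\<lambda>v. \<phi> \<xi> v)" for \<xi>
      using W.adj_linear[OF DP] V_hom unfolding \<phi>_def
      by (auto intro!: module_hom_diffI d.hom_right simp: adj_End_carrier P)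
    show "lift2 (\<lambda>x y. \<phi> x (act V' y v)) (coprod H' \<xi>) = 0" for \<xi> v
      using d.equivariant[OF P, of v \<xi>] W.adj_eval[OF DP, of \<xi> v]
      by (simp add: \<phi>_def lift2_diff)
  qed
  then show "D (adj \<xi> P) v = W.adj \<xi> (D P) v"
    by (simp add: \<phi>_def)
qed

text \<open>The outer map uses the adjoint action of \<open>H'\<close> on \<open>D P\<close>.
  \<open>D_adj\<close> moves it inside as the adjoint action of \<open>H\<close> on
  \<open>P\<close>; then the sums over \<open>F\<close> and \<open>G\<close> merge into one over the
  product \<open>G * F\<close>, the unit tensor.\<close>

lemma D_inverse:
  assumes P: "P \<in> End_carrier V"
  shows "D_map H' G V' (D P) = P"
proof
  fix v
  interpret swap: twist_pair H' H G F by (rule swap)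
  interpret e: pairing H "End_carrier V" "End_alg H V" UNIV V UNIV V "\<lambda>P v. P v"
    by (rule pairing_eval)
  have lin: "bilinear_map s (scale V) (\<lambda>a b. adj a P (act V b v))"
    using P by (auto intro!: linear_intros adj_hom_comp adj_linear module_hom_comp[OF _ adj_linear] End_linear)
  have "D_map H' G V' (D P) v = lift2 (\<lambda>f g. D (adj f P) (act V g v)) F"
    by (simp add: D_map_def[of H' G V'] lift2_comp_apply swap.inverse2_F D_adj[OF P])
  also have "\<dots> = lift2 (\<lambda>a b. adj a P (act V b v)) (tmult2 s G F)"
    unfolding lift2_tmult2[OF lin] D_apply
    by (subst lift2_swap) (simp add: adj_mult[OF End_linear[OF P]] V.act_mult)
  also have "\<dots> = P v"
    by (simp add: GF lift2_tone2[OF lin] adj_one[OF End_linear[OF P]] V.act_one)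
  finally show "D_map H' G V' (D P) v = P v" .
qed

text \<open>These are equalities of records, so facts about the twice deformed bimodule, obtained
  with the roles exchanged, become literally facts about \<open>V\<close>.\<close>

lemma deform_deform: "deform_alg H' G A' = A" "deform_bimod H' G A' V' = V"
  using star_star[OF V.base.pairing_amult] star_star[OF V.pairing_lmul] star_star[OF V.pairing_rmul]
  by (simp_all add: deform_alg_def deform_bimod_def)

lemma swap_bimodule: "twist_bimodule H' H G F A' V'"
  unfolding twist_bimodule_def using swap W.hopf_bimodule_axioms by simp

lemma D_bij: "bij_betw D (End_carrier V) (End_carrier V')"
proof -
  interpret swap: twist_bimodule H' H G F A' V' by (rule swap_bimodule)
  show ?thesis
  proof (rule bij_betw_byWitness[where f' = "D_map H' G V'"])
    show "\<forall>Q\<in>End_carrier V'. D (D_map H' G V' Q) = Q"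
      using swap.D_inverse unfolding deform_deform by blast
    show "D_map H' G V' ` End_carrier V' \<subseteq> End_carrier V"
      using swap.D_in_End unfolding deform_deform by blast
  qed (auto simp: D_inverse D_in_End)
qed

lemma D_iso:
  "module_bimodule_algebra_iso H' A' (End_carrier V) (deform_bimod_alg H F A (End_alg H V))
    (End_carrier V') (End_alg H' V') D"
proof -
  interpret d: pairing H' "End_carrier V" "End_alg H V" UNIV V UNIV V D
    by (rule pairing_D)
  note E = End_bimodule_algebra[unfolded module_bimodule_algebra_on_def]
  have "halg_of (deform_bimod_alg H F A (End_alg H V)) = deform_alg H F (halg_of (End_alg H V))"
    by (simp add: halg_of_def deform_alg_def deform_bimod_alg_def deform_bimod_def)
  moreover have "module_bimodule_on (End_carrier V) H' A' (deform_bimod_alg H F A (End_alg H V))"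
    by (rule module_bimodule_on_cong[OF module_bimodule_deform[of "End_carrier V" A "End_alg H V"]])
      (simp_all add: E deform_bimod_alg_def)
  ultimately have "module_bimodule_algebra_on (End_carrier V) H' A' (deform_bimod_alg H F A (End_alg H V))"
    using module_algebra_deform[OF E[THEN conjunct2]] by (simp add: module_bimodule_algebra_on_def)
  then show ?thesis
    unfolding module_bimodule_algebra_iso_def
    using W.End_bimodule_algebra D_bij D_comp D_id D_lmul_comp D_rmul_comp D_adj d.add_left d.scale_left
    by (simp add: deform_bimod_alg_def deform_bimod_def fun_eq_iff)
qed

end


section \<open>The twisted Hopf algebra\<close>

lemma lift2_hom_eq:
  assumes "lift2 \<beta> T = c" "module_hom t r h"
  shows "lift2 (\<lambda>x y. h (\<beta> x y)) T = h c"
  using lift2_hom[OF assms(2), of \<beta> T] assms(1) by simp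

locale hopf_twist = hopf_algebra H for H :: "('k::comm_ring_1, 'h::ring_1) hopf" +
  fixes F :: "'h tensor2"
  assumes twist: "twist H F"
begin

abbreviation "G \<equiv> inverse2 s F"

text \<open>The candidate for the inverse of \<chi>. Since \<open>twist_chi_inv\<close> is a
  definite description, an explicit witness has to be provided.\<close>

definition \<chi>' :: 'h
  where "\<chi>' = lift2 (\<lambda>x y. S x * y) G"

abbreviation \<chi> :: 'h
  where "\<chi> \<equiv> twist_chi H F"

lemma F_closed: "F \<in> tensors2 s"
  and cocycle_F: "tmult3 s (tensor_one s F) (map_left s \<Delta> F) = tmult3 s (one_tensor s F) (map_right s \<Delta> F)"
  and counit_F: "lift2 (\<lambda>x y. s (\<epsilon> x) y) F = 1" "lift2 (\<lambda>x y. s (\<epsilon> y) x) F = 1"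
  using twist by (auto simp: twist_def)

lemma G_inverse: "is_inverse2 s F G"
  using twist alg.inverse2_eq by (metis twist_def)

lemma G_closed: "G \<in> tensors2 s" and FG: "tmult2 s F G = tone2 s" and GF: "tmult2 s G F = tone2 s"
  using G_inverse by (auto simp: is_inverse2_def)

lemma counit_G: "lift2 (\<lambda>x y. s (\<epsilon> x) y) G = 1" "lift2 (\<lambda>x y. s (\<epsilon> y) x) G = 1"
  using counit_tmult2[of F G] by (simp_all add: FG counit_F counit_tone2)

lemma FG3:
  "tmult3 s (tensor_one s G) (tensor_one s F) = alg.tone3" "tmult3 s (one_tensor s G) (one_tensor s F) = alg.tone3"
  "tmult3 s (tensor_one s F) (tensor_one s G) = alg.tone3" "tmult3 s (one_tensor s F) (one_tensor s G) = alg.tone3"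
  "tmult3 s (map_left s \<Delta> F) (map_left s \<Delta> G) = alg.tone3" "tmult3 s (map_right s \<Delta> F) (map_right s \<Delta> G) = alg.tone3"
  "tmult3 s (map_left s \<Delta> G) (map_left s \<Delta> F) = alg.tone3" "tmult3 s (map_right s \<Delta> G) (map_right s \<Delta> F) = alg.tone3"
  by (simp_all add: GF FG alg.tensor_one_one alg.one_tensor_one map_one
      flip: alg.tensor_one_mult alg.one_tensor_mult map_mult)

lemma tmult3_cancel:
  assumes "tmult3 s X Y = alg.tone3" "Z \<in> tensors3 s"
  shows "tmult3 s X (tmult3 s Y Z) = Z"
  using assms by (simp add: alg.tmult3_one flip: alg.tmult3_assoc)

text \<open>Inverting the cocycle identity of \<open>F\<close> reverses the factors; each side of
  the claim is inverse to the common value of the two sides there.\<close>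

lemma cocycle_G: "tmult3 s (map_left s \<Delta> G) (tensor_one s G) = tmult3 s (map_right s \<Delta> G) (one_tensor s G)"
proof (rule alg.tmult3_inverse_unique[symmetric])
  show "tmult3 s (tmult3 s (map_right s \<Delta> G) (one_tensor s G)) (tmult3 s (one_tensor s F) (map_right s \<Delta> F)) = alg.tone3"
    by (simp add: alg.tmult3_assoc tmult3_cancel FG3)
  show "tmult3 s (tmult3 s (one_tensor s F) (map_right s \<Delta> F)) (tmult3 s (map_left s \<Delta> G) (tensor_one s G)) = alg.tone3"
    unfolding cocycle_F[symmetric] by (simp add: alg.tmult3_assoc tmult3_cancel FG3)
qed simp_all

text \<open>The cocycle identity arranged so that one side has a coproduct in each factor, where
  antipodes can collapse, while the other side has none and contracts to a product of \<chi> and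
  \<open>\<chi>'\<close>.\<close>

lemma cocycle_mixed:
  "tmult3 s (map_right s \<Delta> F) (map_left s \<Delta> G) = tmult3 s (one_tensor s G) (tensor_one s F)"
  "tmult3 s (map_left s \<Delta> F) (map_right s \<Delta> G) = tmult3 s (tensor_one s G) (one_tensor s F)"
proof -
  have "tmult3 s (one_tensor s G) (tensor_one s F)
      = tmult3 s (one_tensor s G) (tmult3 s (tmult3 s (tensor_one s F) (map_left s \<Delta> F)) (map_left s \<Delta> G))"
    by (simp add: alg.tmult3_assoc FG3 alg.tmult3_one)
  also have "\<dots> = tmult3 s (map_right s \<Delta> F) (map_left s \<Delta> G)"
    unfolding cocycle_F by (simp add: alg.tmult3_assoc tmult3_cancel FG3)
  finally show "tmult3 s (map_right s \<Delta> F) (map_left s \<Delta> G) = tmult3 s (one_tensor s G) (tensor_one s F)" ..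
  have "tmult3 s (tensor_one s G) (one_tensor s F)
      = tmult3 s (tensor_one s G) (tmult3 s (tmult3 s (one_tensor s F) (map_right s \<Delta> F)) (map_right s \<Delta> G))"
    by (simp add: alg.tmult3_assoc FG3 alg.tmult3_one)
  also have "\<dots> = tmult3 s (map_left s \<Delta> F) (map_right s \<Delta> G)"
    unfolding cocycle_F[symmetric] by (simp add: alg.tmult3_assoc tmult3_cancel FG3)
  finally show "tmult3 s (map_left s \<Delta> F) (map_right s \<Delta> G) = tmult3 s (tensor_one s G) (one_tensor s F)" ..
qed

section \<open>The twisted antipode\<close>

lemma \<chi>_hom:
  assumes "module_hom s s h"
  shows "lift2 (\<lambda>f f'. h (f * S f')) F = h \<chi>" "lift2 (\<lambda>f f'. h (S f * f')) G = h \<chi>'"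
  by (rule lift2_hom_eq[OF _ assms], simp add: twist_chi_def \<chi>'_def)+

lemma counit_hom_eq:
  assumes "module_hom s s h"
  shows "lift2 (\<lambda>f f'. s (\<epsilon> f) (h f')) F = h 1" "lift2 (\<lambda>f f'. s (\<epsilon> f') (h f)) F = h 1"
    "lift2 (\<lambda>f f'. s (\<epsilon> f) (h f')) G = h 1" "lift2 (\<lambda>f f'. s (\<epsilon> f') (h f)) G = h 1"
  unfolding module_hom.scale[OF assms, symmetric]
  by (rule lift2_hom_eq[OF _ assms], rule counit_F counit_G)+

text \<open>
  Apply \<open>x S(y) z\<close> to \<open>(id \<otimes> \<Delta>)F (\<Delta> \<otimes> id)F\<^sup>-\<^sup>1 = (1 \<otimes> F\<^sup>-\<^sup>1)(F \<otimes> 1)\<close>, and \<open>S(x) y S(z)\<close> to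
  \<open>(\<Delta> \<otimes> id)F (id \<otimes> \<Delta>)F\<^sup>-\<^sup>1 = (F\<^sup>-\<^sup>1 \<otimes> 1)(1 \<otimes> F)\<close>.
\<close>

lemma \<chi>_inverse: "\<chi> * \<chi>' = 1" "\<chi>' * \<chi> = 1"
proof -
  define \<gamma> where "\<gamma> x y z = x * S y * z" for x y z
  have \<gamma>: "trilinear_map s s \<gamma>"
    unfolding \<gamma>_def by (auto intro!: linear_intros)
  have "\<chi> * \<chi>' = lift2 (\<lambda>g g'. lift2 (\<lambda>f f'. f * S f' * (S g * g')) F) G"
    by (subst \<chi>_hom(1)[where h = "\<lambda>u. u * v" for v], (auto intro!: linear_intros)[1], subst \<chi>_hom(2))
      (auto intro!: linear_intros)
  also have "\<dots> = lift3 \<gamma> (tmult3 s (one_tensor s G) (tensor_one s F))"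
    by (simp add: lift3_tmult3[OF \<gamma>] lift3_one_tensor[where s = s and t = s]
        lift3_tensor_one[where s = s and t = s] linear_intros trilinear_map_compose[OF \<gamma>])
      (simp add: \<gamma>_def antipode_mult mult.assoc)
  also have "\<dots> = lift3 \<gamma> (tmult3 s (map_right s \<Delta> F) (map_left s \<Delta> G))"
    by (simp add: cocycle_mixed)
  also have "\<dots> = lift2 (\<lambda>f f'. lift2 (\<lambda>a b. lift2 (\<lambda>g g'. lift2 (\<lambda>c d. f * (c * S d) * S a * b * g') (\<Delta> g)) G) (\<Delta> f')) F"
    by (simp add: lift3_tmult3[OF \<gamma>] lift3_map_left[where s = s and t = s]
        lift3_map_right[where s = s and t = s] linear_intros trilinear_map_compose[OF \<gamma>])
      (simp add: \<gamma>_def antipode_mult mult.assoc)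
  also have "\<dots> = lift2 (\<lambda>f f'. lift2 (\<lambda>a b. f * (S a * b)) (\<Delta> f')) F"
    by (subst lift2_antipode_right[where h = "\<lambda>u. f * u * S a * b * g'" and t = s for f a b g'],
        (auto intro!: linear_intros)[1], subst counit_hom_eq, auto intro!: linear_intros simp: mult.assoc)
  also have "\<dots> = 1"
    by (subst lift2_antipode_left[where t = s], (auto intro!: linear_intros)[1], subst counit_hom_eq)
      (auto intro!: linear_intros)
  finally show "\<chi> * \<chi>' = 1" .
next
  define \<gamma> where "\<gamma> x y z = S x * y * S z" for x y z
  have \<gamma>: "trilinear_map s s \<gamma>"
    unfolding \<gamma>_def by (auto intro!: linear_intros)
  have "\<chi>' * \<chi> = lift2 (\<lambda>g g'. lift2 (\<lambda>f f'. S g * g' * (f * S f')) F) G"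
    by (subst \<chi>_hom(1)[where h = "\<lambda>u. v * u" for v], (auto intro!: linear_intros)[1], subst \<chi>_hom(2)[where h = "\<lambda>u. u * \<chi>"])
      (auto intro!: linear_intros)
  also have "\<dots> = lift3 \<gamma> (tmult3 s (tensor_one s G) (one_tensor s F))"
    by (simp add: lift3_tmult3[OF \<gamma>] lift3_one_tensor[where s = s and t = s]
        lift3_tensor_one[where s = s and t = s] linear_intros trilinear_map_compose[OF \<gamma>])
      (simp add: \<gamma>_def antipode_mult mult.assoc)
  also have "\<dots> = lift3 \<gamma> (tmult3 s (map_left s \<Delta> F) (map_right s \<Delta> G))"
    by (simp add: cocycle_mixed)
  also have "\<dots> = lift2 (\<lambda>f f'. lift2 (\<lambda>a b. lift2 (\<lambda>g g'. lift2 (\<lambda>c d. S g * S a * b * (c * S d) * S f') (\<Delta> g')) G) (\<Delta> f)) F"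
    by (simp add: lift3_tmult3[OF \<gamma>] lift3_map_left[where s = s and t = s]
        lift3_map_right[where s = s and t = s] linear_intros trilinear_map_compose[OF \<gamma>])
      (simp add: \<gamma>_def antipode_mult mult.assoc)
  also have "\<dots> = lift2 (\<lambda>f f'. lift2 (\<lambda>a b. S a * b * S f') (\<Delta> f)) F"
    by (subst lift2_antipode_right[where h = "\<lambda>u. S g * S a * b * u * S f'" and t = s for g a b f'],
        (auto intro!: linear_intros)[1], subst counit_hom_eq, auto intro!: linear_intros simp: antipode_one)
  also have "\<dots> = 1"
    by (subst lift2_antipode_left[where h = "\<lambda>u. u * S f'" and t = s for f'], (auto intro!: linear_intros)[1], subst counit_hom_eq)
      (auto intro!: linear_intros simp: antipode_one)
  finally show "\<chi>' * \<chi> = 1" .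
qed

lemma twist_chi_inv_eq: "twist_chi_inv H F = \<chi>'"
  unfolding twist_chi_inv_def
proof (rule the_equality)
  show "y = \<chi>'" if "\<chi> * y = 1 \<and> y * \<chi> = 1" for y
    using that \<chi>_inverse by (metis mult.assoc mult.left_neutral mult.right_neutral)
qed (simp add: \<chi>_inverse)

lemma twisted_simps [simp]:
  "hscale (twisted H F) = s" "counit (twisted H F) = \<epsilon>"
  "coprod (twisted H F) \<xi> = tmult2 s (tmult2 s F (\<Delta> \<xi>)) G"
  "antipode (twisted H F) \<xi> = \<chi> * S \<xi> * \<chi>'"
  by (simp_all add: twisted_def twist_chi_inv_eq)

lemma lift2_coprod_twisted:
  assumes "bilinear_map s t \<beta>"
  shows "lift2 \<beta> (coprod (twisted H F) \<xi>) = lift2 (\<lambda>f f'. lift2 (\<lambda>x y. lift2 (\<lambda>g g'.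
    \<beta> (f * x * g) (f' * y * g')) G) (\<Delta> \<xi>)) F"
  by (simp add: lift2_tmult2[where t = t] assms linear_intros bilinear_map_compose[OF assms])

text \<open>Expanding \<chi> or \<open>\<chi>'\<close> merges the sums over \<open>F\<close> and
  \<open>G\<close> into the product \<open>G * F\<close>, because the antipode reverses products.
  The contraction of the unit tensor is 1. These identities remove the innermost conjugating tensor
  in the twisted antipode axioms.\<close>

lemma twist_conjugate:
  "lift2 (\<lambda>g g'. g * \<chi> * S g') G = 1" "lift2 (\<lambda>f f'. S f * \<chi>' * f') F = 1"
proof -
  have "lift2 (\<lambda>g g'. g * \<chi> * S g') G = lift2 (\<lambda>g g'. lift2 (\<lambda>f f'. g * (f * S f') * S g') F) G"
    by (subst \<chi>_hom[where h = "\<lambda>u. g * u * S g'" for g g']) (auto intro!: linear_intros)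
  also have "\<dots> = lift2 (\<lambda>x y. x * S y) (tmult2 s G F)"
    by (subst lift2_tmult2[where t = s]) (auto intro!: linear_intros simp: antipode_mult mult.assoc)
  also have "\<dots> = 1"
    unfolding GF by (subst lift2_tone2[where t = s]) (auto intro!: linear_intros simp: antipode_one)
  finally show "lift2 (\<lambda>g g'. g * \<chi> * S g') G = 1" .
  have "lift2 (\<lambda>f f'. S f * \<chi>' * f') F = lift2 (\<lambda>f f'. lift2 (\<lambda>g g'. S f * (S g * g') * f') G) F"
    by (subst \<chi>_hom[where h = "\<lambda>u. S f * u * f'" for f f']) (auto intro!: linear_intros)
  also have "\<dots> = lift2 (\<lambda>x y. S x * y) (tmult2 s G F)"
    by (subst lift2_tmult2[where t = s], (auto intro!: linear_intros)[1], subst lift2_swap)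
      (simp add: antipode_mult mult.assoc)
  also have "\<dots> = 1"
    unfolding GF by (subst lift2_tone2[where t = s]) (auto intro!: linear_intros simp: antipode_one)
  finally show "lift2 (\<lambda>f f'. S f * \<chi>' * f') F = 1" .
qed

text \<open>The product telescopes from the inside: \<open>twist_conjugate\<close> removes one
  conjugating tensor, the antipode axiom of \<open>H\<close> turns the legs of \<xi> into a counit,
  and the other tensor contracts to \<open>\<chi>'\<close> or \<chi>, which cancels against its
  inverse.\<close>

lemma antipode_twisted:
  "lift2 (\<lambda>x y. antipode (twisted H F) x * y) (coprod (twisted H F) \<xi>) = s (\<epsilon> \<xi>) 1"
  "lift2 (\<lambda>x y. x * antipode (twisted H F) y) (coprod (twisted H F) \<xi>) = s (\<epsilon> \<xi>) 1"
proof -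
  have "lift2 (\<lambda>x y. antipode (twisted H F) x * y) (coprod (twisted H F) \<xi>)
      = lift2 (\<lambda>f f'. lift2 (\<lambda>x y. lift2 (\<lambda>g g'. \<chi> * S g * S x * (S f * \<chi>' * f') * (y * g')) G) (\<Delta> \<xi>)) F"
    by (subst lift2_coprod_twisted[where t = s])
      (auto intro!: linear_intros simp: antipode_mult mult.assoc)
  \<comment> \<open>The sum over \<open>F\<close> is moved innermost, so that it encloses just the
    factor that it contracts.\<close>
  also have "\<dots> = lift2 (\<lambda>x y. lift2 (\<lambda>g g'. lift2 (\<lambda>f f'. \<chi> * S g * S x * (S f * \<chi>' * f') * (y * g')) F) G) (\<Delta> \<xi>)"
    by (simp only: lift2_swap[where T = F])
  also have "\<dots> = lift2 (\<lambda>g g'. lift2 (\<lambda>x y. \<chi> * S g * (S x * y) * g') (\<Delta> \<xi>)) G"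
    by (subst lift2_hom_eq[OF twist_conjugate(2), where h = "\<lambda>u. \<chi> * S g * S x * u * (y * g')" for g x y g'],
        (auto intro!: linear_intros)[1], subst lift2_swap) (simp add: mult.assoc)
  also have "\<dots> = lift2 (\<lambda>g g'. s (\<epsilon> \<xi>) (\<chi> * (S g * g'))) G"
    by (subst lift2_antipode_left[where h = "\<lambda>u. \<chi> * S g * u * g'" and t = s for g g'])
      (auto intro!: linear_intros simp: mult.assoc)
  also have "\<dots> = s (\<epsilon> \<xi>) 1"
    by (subst \<chi>_hom[where h = "\<lambda>u. s (\<epsilon> \<xi>) (\<chi> * u)"]) (auto intro!: linear_intros simp: \<chi>_inverse)
  finally show "lift2 (\<lambda>x y. antipode (twisted H F) x * y) (coprod (twisted H F) \<xi>) = s (\<epsilon> \<xi>) 1" .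
  have "lift2 (\<lambda>x y. x * antipode (twisted H F) y) (coprod (twisted H F) \<xi>)
      = lift2 (\<lambda>f f'. lift2 (\<lambda>x y. lift2 (\<lambda>g g'. f * x * (g * \<chi> * S g') * S y * S f' * \<chi>') G) (\<Delta> \<xi>)) F"
    by (subst lift2_coprod_twisted[where t = s])
      (auto intro!: linear_intros simp: antipode_mult mult.assoc)
  also have "\<dots> = lift2 (\<lambda>f f'. lift2 (\<lambda>x y. f * (x * S y) * S f' * \<chi>') (\<Delta> \<xi>)) F"
    by (subst lift2_hom_eq[OF twist_conjugate(1), where h = "\<lambda>u. f * x * u * S y * S f' * \<chi>'" for f x y f'])
      (auto intro!: linear_intros simp: mult.assoc)
  also have "\<dots> = lift2 (\<lambda>f f'. s (\<epsilon> \<xi>) (f * S f' * \<chi>')) F"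
    by (subst lift2_antipode_right[where h = "\<lambda>u. f * u * S f' * \<chi>'" and t = s for f f'])
      (auto intro!: linear_intros)
  also have "\<dots> = s (\<epsilon> \<xi>) 1"
    by (subst \<chi>_hom[where h = "\<lambda>u. s (\<epsilon> \<xi>) (u * \<chi>')"]) (auto intro!: linear_intros simp: \<chi>_inverse)
  finally show "lift2 (\<lambda>x y. x * antipode (twisted H F) y) (coprod (twisted H F) \<xi>) = s (\<epsilon> \<xi>) 1" .
qed

text \<open>Each side splits into three factors: a side of the cocycle identity of \<open>F\<close>,
  an iterated coproduct of \<xi>, and a side of the one for \<open>G\<close>. They agree factor by
  factor.\<close>

lemma twisted_coassociative:
  "map_left s (coprod (twisted H F)) (coprod (twisted H F) \<xi>)
    = map_right s (coprod (twisted H F)) (coprod (twisted H F) \<xi>)"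
proof -
  have 1: "map_left s (coprod (twisted H F)) (coprod (twisted H F) \<xi>)
      = tmult3 s (tmult3 s (tensor_one s F) (map_left s \<Delta> F))
        (tmult3 s (map_left s \<Delta> (\<Delta> \<xi>)) (tmult3 s (map_left s \<Delta> G) (tensor_one s G)))"
    by (simp add: alg.map_left_conj[OF twisted_simps(3) lift2_coprod_hom[OF _ alg.self_hom]] alg.tmult3_assoc map_mult)
  have 2: "map_right s (coprod (twisted H F)) (coprod (twisted H F) \<xi>)
      = tmult3 s (tmult3 s (one_tensor s F) (map_right s \<Delta> F))
        (tmult3 s (map_right s \<Delta> (\<Delta> \<xi>)) (tmult3 s (map_right s \<Delta> G) (one_tensor s G)))"
    by (simp add: alg.map_right_conj[OF twisted_simps(3) lift2_coprod_hom[OF _ alg.self_hom]] alg.tmult3_assoc map_mult)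
  show ?thesis
    unfolding 1 2 cocycle_F cocycle_G coassociative ..
qed

lemma tmult2_cancel:
  assumes "tmult2 s T U = tone2 s" "W \<in> tensors2 s"
  shows "tmult2 s T (tmult2 s U W) = W"
  using assms by (simp add: alg.tmult2_one flip: alg.tmult2_assoc)

lemma twisted_hopf: "hopf_algebra (twisted H F)"
proof (rule hopf_algebra.intro, unfold twisted_simps(1,2))
  show "module_hom s s (antipode (twisted H F))"
    unfolding twisted_simps by (auto intro!: linear_intros)
\<comment> \<open>These two facts are applied first, since the simplification that follows would
  unfold the twisted coproduct and antipode in the goals that they solve.\<close>
qed (simp_all only: antipode_twisted twisted_coassociative,
    simp_all add: algebra coprod_add coprod_scale coprod_mult coprod_one alg.tmult2_tadd2 alg.tmult2_tscale2
      alg.tmult2_assoc tmult2_cancel GF FG alg.tmult2_one F_closed G_closed counit_linear counit_mult counit_one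
      counit_tmult2 counit_F counit_G counit_left counit_right)

lemma twist_pair_twisted: "twist_pair H (twisted H F) F G"
proof -
  interpret tw: hopf_algebra "twisted H F"
    by (rule twisted_hopf)
  show ?thesis
    by unfold_locales (simp_all add: F_closed G_closed FG GF cocycle_G counit_G)
qed

end

theorem theorem2p8:
  fixes H :: "('k::comm_ring_1, 'h::ring_1) hopf"
    and F :: "'h tensor2"
    and A :: "('k, 'h, 'a::ab_group_add) halg"
    and V :: "('k, 'h, 'a, 'v::ab_group_add) hbimod"
  assumes "hopf_algebra H"
    and "twist H F"
    and "module_algebra H A"
    and "module_bimodule H A V"
  shows "module_bimodule_algebra_iso (twisted H F) (deform_alg H F A)
    (End_carrier V) (deform_bimod_alg H F A (End_alg H V))
    (End_carrier (deform_bimod H F A V)) (End_alg (twisted H F) (deform_bimod H F A V))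
    (D_map H F V)"
proof -
  interpret hopf_twist H F
    unfolding hopf_twist_def hopf_twist_axioms_def using assms by simp
  interpret twist_bimodule H "twisted H F" F G A V
    unfolding twist_bimodule_def hopf_bimodule_def using assms twist_pair_twisted by simp
  show ?thesis
    by (rule D_iso)
qed

end
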